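(* Let $G$ be a good bipartite graph (in the sense defined in the context) with $m$ vertices, $n$ edges and exactly $p$ four-cycles, let $R=K[x_1,\dots,x_n]/I(G)$, and let $\mathbf{e}$ be the Hilbert-Samuel multiplicity of $R$ at the origin, i.e. with respect to the maximal ideal $\mathfrak m=\langle x_1,\dots,x_n\rangle$. Then $$\mathbf{e}=\frac{(m-2)!}{(n-1)!}\sum_{r=0}^{p}(-1)^{r}\binom{p}{r}\left\{\sum_{i=0}^{n-m+1}(-1)^{i}{n \brack m+i-1}\binom{m+i-2}{i}(2r)^{i}\right\}.$$
   Context: $K$ is a field and $G$ is a finite simple connected bipartite graph with vertex set $V(G)=\{1,\dots,m\}$ and $n\ge 1$ edges $e_1,\dots,e_n$. A variable $x_i$ is attached to each edge $e_i$. The toric ideal $I(G)\subset K[x_1,\dots,x_n]$ is the kernel of the $K$-algebra homomorphism $K[x_1,\dots,x_n]\to K[t_1,\dots,t_m]$ sending $x_i$ to $t_at_b$ when $e_i=\{a,b\}$. It is assumed that $I(G)$ is generated by quadratic binomials. Let $p$ be the number of 4-cycles of $G$ (as subgraphs). A 4-cycle with consecutive edges $(e_a,e_b,e_c,e_d)$ gives the binomial $x_ax_c-x_bx_d\in I(G)$. For the $i$-th 4-cycle, one of its two monomials $x_ax_c$, $x_bx_d$ is chosen and called $z_i$ (the non-standard one); the other is called $w_i$; put $f_i=w_i-z_i$, so that $I(G)=\langle f_1,\dots,f_p\rangle$. The graph $G$ (with $I(G)$ generated by quadratic binomials) is called good if these choices can be made so that: (a) the monomials $z_1,\dots,z_p$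 are pairwise coprime; and (b) for every $t\ge 1$ and all indices $i_1,\dots,i_t\in\{1,\dots,p\}$ (not necessarily distinct), $\prod_{s=1}^t w_{i_s}\ne\prod_{s=1}^t z_{i_s}$ as monomials in $K[x_1,\dots,x_n]$. Hilbert-Samuel multiplicity: if $R$ has Krull dimension $d+1$ at $\mathfrak m$ and $P(k)$ is the polynomial that agrees with $\dim_K \mathfrak m^k/\mathfrak m^{k+1}$ for all large $k$, then $\mathbf{e}$ is $d!$ times the coefficient of $k^d$ in $P$. ${k \brack l}$ denotes the (unsigned) Stirling number of the first kind, defined by $x(x+1)\cdots(x+k-1)=\sum_{l=1}^{k}{k \brack l}x^l$ for $k\geq 1$. The convention $0^0=1$ is used. *)

theory Defs
  imports
    "HOL-Library.Poly_Mapping"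
    "HOL-Library.Extended_Nat"
    "HOL-Computational_Algebra.Polynomial"
    "HOL-Combinatorics.Stirling"
    "HOL-Algebra.QuotRing"
    "HOL-Algebra.Ideal_Product"
    "HOL-Algebra.Embedded_Algebras"
begin

section \<open>Polynomial rings in finitely many variables\<close>

text \<open>A monomial is represented by its exponent vector, so that multiplication of monomials is
  addition of exponent vectors.\<close>

type_synonym monomial = "nat \<Rightarrow>\<^sub>0 nat"
type_synonym 'k mpoly = "monomial \<Rightarrow>\<^sub>0 'k"

definition Const :: "'k::field \<Rightarrow> 'k mpoly" where
  "Const c = Poly_Mapping.single 0 c"

definition Var :: "nat \<Rightarrow> 'k::field mpoly" where
  "Var i = Poly_Mapping.single (Poly_Mapping.single i 1) 1"

definition mpoly_ring :: "nat set \<Rightarrow> 'k::field mpoly ring" where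
  "mpoly_ring A = \<lparr>carrier = {f. \<forall>u\<in>Poly_Mapping.keys f. Poly_Mapping.keys u \<subseteq> A},
     mult = (*), one = 1, zero = 0, add = (+)\<rparr>"

section \<open>Graphs\<close>

text \<open>The vertices are $1,\dots,m$ and the edges $e_1,\dots,e_n$ are given by
  \<open>edge i\<close>, $1 \le i \le n$, where an edge is the set of its two end points.\<close>

definition simple_graph :: "nat \<Rightarrow> nat \<Rightarrow> (nat \<Rightarrow> nat set) \<Rightarrow> bool" where
  "simple_graph m n edge \<longleftrightarrow>
     (\<forall>i\<in>{1..n}. edge i \<subseteq> {1..m} \<and> card (edge i) = 2) \<and> inj_on edge {1..n}"

definition connected_graph :: "nat \<Rightarrow> nat \<Rightarrow> (nat \<Rightarrow> nat set) \<Rightarrow> bool" where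
  "connected_graph m n edge \<longleftrightarrow>
     (\<forall>u\<in>{1..m}. \<forall>v\<in>{1..m}. (u, v) \<in> {(a, b). \<exists>i\<in>{1..n}. edge i = {a, b}}\<^sup>*)"

definition bipartite_graph :: "nat \<Rightarrow> nat \<Rightarrow> (nat \<Rightarrow> nat set) \<Rightarrow> bool" where
  "bipartite_graph m n edge \<longleftrightarrow>
     (\<exists>A B. A \<union> B = {1..m} \<and> A \<inter> B = {} \<and>
        (\<forall>i\<in>{1..n}. \<exists>a\<in>A. \<exists>b\<in>B. edge i = {a, b}))"

text \<open>\<open>consecutive_edges n edge a b c d\<close>: the edges $e_a, e_b, e_c, e_d$ are, in this order, the
  consecutive edges of a 4-cycle. As a subgraph, a 4-cycle is determined by its edges.\<close>

definition consecutive_edges ::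
    "nat \<Rightarrow> (nat \<Rightarrow> nat set) \<Rightarrow> nat \<Rightarrow> nat \<Rightarrow> nat \<Rightarrow> nat \<Rightarrow> bool" where
  "consecutive_edges n edge a b c d \<longleftrightarrow>
     {a, b, c, d} \<subseteq> {1..n} \<and>
     (\<exists>v1 v2 v3 v4. distinct [v1, v2, v3, v4] \<and>
        edge a = {v1, v2} \<and> edge b = {v2, v3} \<and> edge c = {v3, v4} \<and> edge d = {v4, v1})"

definition four_cycles :: "nat \<Rightarrow> (nat \<Rightarrow> nat set) \<Rightarrow> nat set set" where
  "four_cycles n edge = {{a, b, c, d} | a b c d. consecutive_edges n edge a b c d}"

text \<open>The 4-cycles themselves serve as indices for the chosen monomials \<open>z\<close> (non-standard) and
  \<open>w\<close>. Both choices for a given 4-cycle are available, since the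
  enumeration of its consecutive edges may start at any edge.\<close>

definition admissible_choice ::
    "nat \<Rightarrow> (nat \<Rightarrow> nat set) \<Rightarrow> (nat set \<Rightarrow> monomial) \<Rightarrow> (nat set \<Rightarrow> monomial) \<Rightarrow> bool" where
  "admissible_choice n edge z w \<longleftrightarrow>
     (\<forall>C\<in>four_cycles n edge. \<exists>a b c d. consecutive_edges n edge a b c d \<and> C = {a, b, c, d} \<and>
        z C = Poly_Mapping.single a 1 + Poly_Mapping.single c 1 \<and>
        w C = Poly_Mapping.single b 1 + Poly_Mapping.single d 1)"

definition coprime_monomials :: "monomial \<Rightarrow> monomial \<Rightarrow> bool" where
  "coprime_monomials u v \<longleftrightarrow> Poly_Mapping.keys u \<inter> Poly_Mapping.keys v = {}"

text \<open>The choices required of a good graph; the standing assumption that the toric ideal is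
  generated by quadratic binomials is not included here.\<close>

definition has_good_choice :: "nat \<Rightarrow> (nat \<Rightarrow> nat set) \<Rightarrow> bool" where
  "has_good_choice n edge \<longleftrightarrow>
     (\<exists>z w. admissible_choice n edge z w \<and>
        (\<forall>C\<in>four_cycles n edge. \<forall>D\<in>four_cycles n edge.
            C \<noteq> D \<longrightarrow> coprime_monomials (z C) (z D)) \<and>
        (\<forall>Cs. Cs \<noteq> [] \<and> set Cs \<subseteq> four_cycles n edge \<longrightarrow>
            sum_list (map w Cs) \<noteq> sum_list (map z Cs)))"

section \<open>Toric ideals\<close>

text \<open>Substitution of $t_a t_b$ for $x_i$ where $e_i = \{a,b\}$.\<close>

definition toric_hom :: "(nat \<Rightarrow> nat set) \<Rightarrow> 'k::field mpoly \<Rightarrow> 'k mpoly" where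
  "toric_hom edge f =
     (\<Sum>u\<in>Poly_Mapping.keys f. Const (Poly_Mapping.lookup f u) *
        (\<Prod>i\<in>Poly_Mapping.keys u. (\<Prod>v\<in>edge i. Var v) ^ Poly_Mapping.lookup u i))"

definition toric_ideal :: "nat \<Rightarrow> nat \<Rightarrow> (nat \<Rightarrow> nat set) \<Rightarrow> 'k::field mpoly set" where
  "toric_ideal m n edge = a_kernel (mpoly_ring {1..n}) (mpoly_ring {1..m}) (toric_hom edge)"

definition quadratic_binomials :: "nat \<Rightarrow> 'k::field mpoly set" where
  "quadratic_binomials n =
     {Var a * Var b - Var c * Var d | a b c d.
        {a, b, c, d} \<subseteq> {1..n} \<and> (Var a * Var b :: 'k mpoly) \<noteq> Var c * Var d}"

definition generated_by_quadratic_binomials :: "nat \<Rightarrow> 'k::field mpoly set \<Rightarrow> bool" where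
  "generated_by_quadratic_binomials n I \<longleftrightarrow>
     (\<exists>B \<subseteq> quadratic_binomials n. I = Idl\<^bsub>mpoly_ring {1..n}\<^esub> B)"

definition toric_ring :: "nat \<Rightarrow> nat \<Rightarrow> (nat \<Rightarrow> nat set) \<Rightarrow> 'k::field mpoly set ring" where
  "toric_ring m n edge = mpoly_ring {1..n} Quot toric_ideal m n edge"

definition toric_class ::
    "nat \<Rightarrow> nat \<Rightarrow> (nat \<Rightarrow> nat set) \<Rightarrow> 'k::field mpoly \<Rightarrow> 'k mpoly set" where
  "toric_class m n edge f = toric_ideal m n edge +>\<^bsub>mpoly_ring {1..n}\<^esub> f"

definition toric_scalars :: "nat \<Rightarrow> nat \<Rightarrow> (nat \<Rightarrow> nat set) \<Rightarrow> 'k::field mpoly set set" where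
  "toric_scalars m n edge = toric_class m n edge ` range Const"

definition toric_origin :: "nat \<Rightarrow> nat \<Rightarrow> (nat \<Rightarrow> nat set) \<Rightarrow> 'k::field mpoly set set" where
  "toric_origin m n edge =
     Idl\<^bsub>toric_ring m n edge\<^esub> (toric_class m n edge ` Var ` {1..n})"

section \<open>Hilbert-Samuel multiplicity\<close>

text \<open>The Krull dimension at a prime ideal $M$ is the Krull dimension of the localization at $M$,
  that is, the supremum of the lengths of chains of prime ideals contained in $M$.\<close>

definition krull_dim_at :: "('a, 'b) ring_scheme \<Rightarrow> 'a set \<Rightarrow> enat" where
  "krull_dim_at R M =
     Sup {enat d | d. \<exists>P. (\<forall>i\<le>d. primeideal (P i) R) \<and> (\<forall>i<d. P i \<subset> P (Suc i)) \<and> P d \<subseteq> M}"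

definition ideal_power :: "('a, 'b) ring_scheme \<Rightarrow> 'a set \<Rightarrow> nat \<Rightarrow> 'a set" where
  "ideal_power R M k = M [^]\<^bsub>ideals_set R\<^esub> k"

text \<open>Here \<open>R\<close> is a \<open>K\<close>-algebra with \<open>K\<close> embedded as a subfield. The space $M^k/M^{k+1}$
  is taken as a subspace of the \<open>K\<close>-algebra $R/M^{k+1}$; accordingly, \<open>K\<close> is replaced by its image
  there.\<close>

definition gr_dim :: "('a, 'b) ring_scheme \<Rightarrow> 'a set \<Rightarrow> 'a set \<Rightarrow> nat \<Rightarrow> nat" where
  "gr_dim R K M k =
     (let J = ideal_power R M (k + 1) in
      ring.dim (R Quot J) ((\<lambda>x. J +>\<^bsub>R\<^esub> x) ` K) ((\<lambda>x. J +>\<^bsub>R\<^esub> x) ` ideal_power R M k))"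

definition hs_multiplicity :: "('a, 'b) ring_scheme \<Rightarrow> 'a set \<Rightarrow> 'a set \<Rightarrow> real" where
  "hs_multiplicity R K M =
     (THE e. \<exists>d (P :: real poly). krull_dim_at R M = enat (d + 1) \<and>
        (\<forall>\<^sub>F k in sequentially. poly P (real k) = real (gr_dim R K M k)) \<and>
        e = fact d * Polynomial.coeff P d)"

end

theory Submission
  imports Defs "HOL-Library.Confluence"
begin

text \<open>Rewriting $z_C$ to $w_C$ terminates by condition (b) of goodness and is confluent because the
  $z_C$ are pairwise coprime. As quadratic generation makes the convertibility classes of
  monomials equal to the fibres of the toric map, the monomials of degree $k$ divisible by no $z_C$ are a
  basis of $\mathfrak m^k/\mathfrak m^{k+1}$; inclusion-exclusion counts them, and Stirling numbers
  expand the resulting binomial coefficients into powers of $k$.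

  The Krull dimension at the origin is $m-1$. A chain of primes of this length consists of the
  kernels of the toric map followed by $t_v \mapsto 0$ for $v$ outside a growing connected set of vertices.
  For the upper bound, counting the exponents of the toric monomials, which have equal degree on both
  sides of the bipartition, shows that any $m$ elements of the ring are algebraically dependent over
  $K$; this rules out a chain of primes of length $m$.\<close>

subsection \<open>Polynomial rings\<close>

text \<open>Quadratic generation speaks of an ideal, whereas rewriting needs a statement about pairs
  of monomials. The bridge is the linear map that replaces each monomial by a representative of its
  convertibility class: its kernel is an ideal, and it contains the generators because a nonzero
  binomial x_a x_b - x_c x_d in I(G) is, up to sign, one of the f_i. The toric map doubles degrees,
  so I(G) is homogeneous and the monomials of degree k suffice for the k-th graded piece. The number
  of all monomials of degree k is k(k+1)...(k+n-1) / (k (n-1)!), which is where the Stirling numbers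
  and the factor 1/(n-1)! come from. Inclusion-exclusion replaces k by k - 2r because each z_C has
  degree 2, and the coefficient of k^(m-2) in (k - 2r)^(m+i-2) is binomial(m+i-2, i) (-2r)^i. The
  Krull dimension m - 1 enters the formula by selecting this coefficient and contributing the factor
  (m-2)!.\<close>

lemma carrier_mpoly_ring:
  "f \<in> carrier (mpoly_ring A) \<longleftrightarrow> (\<forall>u\<in>Poly_Mapping.keys f. Poly_Mapping.keys u \<subseteq> A)"
  by (simp add: mpoly_ring_def)

lemma mpoly_ring_simps [simp]:
  "x \<otimes>\<^bsub>mpoly_ring A\<^esub> y = x * y" "x \<oplus>\<^bsub>mpoly_ring A\<^esub> y = x + y"
  "\<one>\<^bsub>mpoly_ring A\<^esub> = 1" "\<zero>\<^bsub>mpoly_ring A\<^esub> = 0"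
  by (simp_all add: mpoly_ring_def)

lemma keys_add_monomial [simp]:
  "Poly_Mapping.keys (u + v) = Poly_Mapping.keys u \<union> Poly_Mapping.keys (v :: monomial)"
  by (auto simp: in_keys_iff lookup_add)

lemma mpoly_ring_closed:
  fixes f g :: "'k::field mpoly"
  assumes "f \<in> carrier (mpoly_ring A)" "g \<in> carrier (mpoly_ring A)"
  shows "f + g \<in> carrier (mpoly_ring A)" "f - g \<in> carrier (mpoly_ring A)"
    "- f \<in> carrier (mpoly_ring A)" "f * g \<in> carrier (mpoly_ring A)"
proof -
  show "f + g \<in> carrier (mpoly_ring A)"
    using assms keys_add[of f g] unfolding carrier_mpoly_ring by blast
  show "f - g \<in> carrier (mpoly_ring A)"
    using assms unfolding carrier_mpoly_ring
    by (metis (no_types, lifting) diff_zero in_keys_iff lookup_minus)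
  show "- f \<in> carrier (mpoly_ring A)"
    using assms by (auto simp: carrier_mpoly_ring in_keys_iff)
  show "f * g \<in> carrier (mpoly_ring A)"
    unfolding carrier_mpoly_ring
  proof
    fix u assume "u \<in> Poly_Mapping.keys (f * g)"
    then obtain a b where "u = a + b" "a \<in> Poly_Mapping.keys f" "b \<in> Poly_Mapping.keys g"
      using keys_mult[of f g] by blast
    then show "Poly_Mapping.keys u \<subseteq> A"
      using assms unfolding carrier_mpoly_ring by auto
  qed
qed

lemma zero_one_mpoly_ring [simp]:
  "0 \<in> carrier (mpoly_ring A)" "1 \<in> carrier (mpoly_ring A)" "Const c \<in> carrier (mpoly_ring A)"
  by (simp_all add: carrier_mpoly_ring Const_def)

lemma Var_in_mpoly_ring: "i \<in> A \<Longrightarrow> Var i \<in> carrier (mpoly_ring A)"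
  by (simp add: carrier_mpoly_ring Var_def)

lemma single_in_mpoly_ring: "Poly_Mapping.keys u \<subseteq> A \<Longrightarrow> Poly_Mapping.single u c \<in> carrier (mpoly_ring A)"
  by (simp add: carrier_mpoly_ring)

lemma sum_in_mpoly_ring:
  "(\<And>x. x \<in> X \<Longrightarrow> f x \<in> carrier (mpoly_ring A)) \<Longrightarrow> sum f X \<in> carrier (mpoly_ring A)"
  by (induction X rule: infinite_finite_induct) (auto intro: mpoly_ring_closed)

lemma prod_list_in_mpoly_ring:
  "(\<And>x. x \<in> set xs \<Longrightarrow> x \<in> carrier (mpoly_ring A)) \<Longrightarrow> prod_list xs \<in> carrier (mpoly_ring A)"
  by (induction xs) (auto intro: mpoly_ring_closed)

lemma power_in_mpoly_ring:
  "f \<in> carrier (mpoly_ring A) \<Longrightarrow> f ^ k \<in> carrier (mpoly_ring A)"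
  by (induction k) (auto intro: mpoly_ring_closed)

lemma cring_mpoly_ring: "cring (mpoly_ring A :: 'k::field mpoly ring)"
proof (rule cringI)
  show "abelian_group (mpoly_ring A :: 'k mpoly ring)"
  proof (rule abelian_groupI)
    fix x assume "x \<in> carrier (mpoly_ring A :: 'k mpoly ring)"
    then show "\<exists>y\<in>carrier (mpoly_ring A). y \<oplus>\<^bsub>mpoly_ring A\<^esub> x = \<zero>\<^bsub>mpoly_ring A\<^esub>"
      by (intro bexI[of _ "- x"]) (auto intro: mpoly_ring_closed)
  qed (auto intro: mpoly_ring_closed)
  show "comm_monoid (mpoly_ring A :: 'k mpoly ring)"
    by (rule comm_monoidI) (auto intro: mpoly_ring_closed simp: algebra_simps)
qed (auto simp: algebra_simps)

lemma minus_mpoly_ring: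
  fixes f :: "'k::field mpoly"
  assumes "f \<in> carrier (mpoly_ring A)"
  shows "\<ominus>\<^bsub>mpoly_ring A\<^esub> f = - f"
proof -
  interpret cring "mpoly_ring A :: 'k mpoly ring"
    by (rule cring_mpoly_ring)
  have "- f \<oplus>\<^bsub>mpoly_ring A\<^esub> f = \<zero>\<^bsub>mpoly_ring A\<^esub>"
    by simp
  then show ?thesis
    using minus_equality[of "- f" f] assms mpoly_ring_closed(3)[OF assms assms] by simp
qed

lemma mpoly_ideal_closed:
  fixes I :: "'k::field mpoly set"
  assumes "ideal I (mpoly_ring A)"
  shows "0 \<in> I" "f \<in> I \<Longrightarrow> g \<in> I \<Longrightarrow> f + g \<in> I" "f \<in> I \<Longrightarrow> - f \<in> I" "f \<in> I \<Longrightarrow> g \<in> I \<Longrightarrow> f - g \<in> I"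
    "f \<in> I \<Longrightarrow> g \<in> carrier (mpoly_ring A) \<Longrightarrow> g * f \<in> I" "I \<subseteq> carrier (mpoly_ring A)"
proof -
  interpret ideal I "mpoly_ring A" by fact
  show z: "0 \<in> I" and a: "f \<in> I \<Longrightarrow> g \<in> I \<Longrightarrow> f + g \<in> I" for f g
    using additive_subgroup.zero_closed additive_subgroup.a_closed is_additive_subgroup by fastforce+
  show sub: "I \<subseteq> carrier (mpoly_ring A)"
    by (rule a_subset)
  show m: "f \<in> I \<Longrightarrow> - f \<in> I" for f
    using additive_subgroup.a_inv_closed[OF is_additive_subgroup, of f] minus_mpoly_ring[of f A] sub
    by auto
  show "f \<in> I \<Longrightarrow> g \<in> I \<Longrightarrow> f - g \<in> I" for f g
    using a[of f "- g"] m[of g] by simp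
  show "f \<in> I \<Longrightarrow> g \<in> carrier (mpoly_ring A) \<Longrightarrow> g * f \<in> I" for f g
    using I_l_closed[of f g] by simp
qed

lemma mpoly_idealI:
  fixes I :: "'k::field mpoly set"
  assumes "I \<subseteq> carrier (mpoly_ring A)" "0 \<in> I" "\<And>f g. f \<in> I \<Longrightarrow> g \<in> I \<Longrightarrow> f + g \<in> I"
    "\<And>f g. f \<in> I \<Longrightarrow> g \<in> carrier (mpoly_ring A) \<Longrightarrow> g * f \<in> I"
  shows "ideal I (mpoly_ring A)"
proof (rule idealI)
  interpret cring "mpoly_ring A :: 'k mpoly ring"
    by (rule cring_mpoly_ring)
  show "ring (mpoly_ring A :: 'k mpoly ring)" by (rule ring_axioms)
  show "subgroup I (add_monoid (mpoly_ring A))"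
  proof (rule add.subgroupI)
    show "\<ominus>\<^bsub>mpoly_ring A\<^esub> a \<in> I" if "a \<in> I" for a
    proof -
      have "(-1) * a \<in> I"
        using assms(4)[OF that, of "-1"] mpoly_ring_closed(3)[of 1 A 1] by simp
      then show ?thesis
        using that assms(1) minus_mpoly_ring[of a A] by auto
    qed
  qed (use assms in auto)
  fix a x :: "'k mpoly"
  assume a: "a \<in> I" and x: "x \<in> carrier (mpoly_ring A)"
  then have "x * a \<in> I" by (rule assms(4))
  then show "x \<otimes>\<^bsub>mpoly_ring A\<^esub> a \<in> I" "a \<otimes>\<^bsub>mpoly_ring A\<^esub> x \<in> I"
    by (simp_all add: mult.commute)
qed

subsection \<open>Ring homomorphisms from maps on monomials\<close>

text \<open>Three maps are instances: the toric map, the collapse of convertibility classes onto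
  representatives, and the toric map cut down to a set of vertices. The collapse need not be
  multiplicative, so the map on monomials is left arbitrary here.\<close>

definition mpoly_extend :: "(monomial \<Rightarrow> 'k mpoly) \<Rightarrow> 'k::field mpoly \<Rightarrow> 'k mpoly" where
  "mpoly_extend \<phi> f = (\<Sum>u\<in>Poly_Mapping.keys f. Const (Poly_Mapping.lookup f u) * \<phi> u)"

lemma Const_simps:
  "Const 0 = 0" "Const 1 = 1" "Const (a + b) = Const a + Const b" "Const (a * b) = Const a * Const b"
  by (simp_all add: Const_def single_add mult_single)

lemma Const_times_single [simp]: "Const c * Poly_Mapping.single u d = Poly_Mapping.single u (c * d)"
  by (simp add: Const_def mult_single)

lemma lookup_Const_times: "Poly_Mapping.lookup (Const c * f) u = c * Poly_Mapping.lookup f u"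
proof -
  have "Const c * f = Poly_Mapping.map ((*) c) f"
    by (simp add: Const_def mult_map_scale_conv_mult)
  then show ?thesis
    by (simp add: Poly_Mapping.map.rep_eq when_def)
qed

lemma mpoly_extend_zero [simp]: "mpoly_extend \<phi> 0 = 0"
  by (simp add: mpoly_extend_def)

lemma mpoly_extend_single: "mpoly_extend \<phi> (Poly_Mapping.single u c) = Const c * \<phi> u"
  by (simp add: mpoly_extend_def Const_simps)

lemma mpoly_extend_add: "mpoly_extend \<phi> (f + g) = mpoly_extend \<phi> f + mpoly_extend \<phi> g"
  unfolding mpoly_extend_def
  by (rule setsum_keys_plus_distrib) (simp_all add: Const_simps algebra_simps)

lemma mpoly_extend_diff: "mpoly_extend \<phi> (f - g) = mpoly_extend \<phi> f - mpoly_extend \<phi> g"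
  using mpoly_extend_add[of \<phi> "f - g" g] by (simp add: eq_diff_eq)

lemma mpoly_extend_sum: "mpoly_extend \<phi> (sum f X) = (\<Sum>x\<in>X. mpoly_extend \<phi> (f x))"
  by (induction X rule: infinite_finite_induct) (auto simp: mpoly_extend_add)

lemma mpoly_eq_sum_single:
  "(f :: 'k::field mpoly) = (\<Sum>u\<in>Poly_Mapping.keys f. Poly_Mapping.single u (Poly_Mapping.lookup f u))"
proof (rule poly_mapping_eqI)
  fix v
  show "Poly_Mapping.lookup f v =
     Poly_Mapping.lookup (\<Sum>u\<in>Poly_Mapping.keys f. Poly_Mapping.single u (Poly_Mapping.lookup f u)) v"
    by (auto simp: lookup_sum lookup_single when_def in_keys_iff)
qed

lemma mpoly_extend_mult:
  fixes f g :: "'k::field mpoly"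
  assumes "\<And>u v. \<phi> (u + v) = \<phi> u * \<phi> v"
  shows "mpoly_extend \<phi> (f * g) = mpoly_extend \<phi> f * mpoly_extend \<phi> g"
proof -
  let ?s = "\<lambda>f u. Poly_Mapping.single u (Poly_Mapping.lookup (f :: 'k mpoly) u)"
  have "mpoly_extend \<phi> (f * g) =
      mpoly_extend \<phi> ((\<Sum>u\<in>Poly_Mapping.keys f. ?s f u) * (\<Sum>v\<in>Poly_Mapping.keys g. ?s g v))"
    using mpoly_eq_sum_single[of f] mpoly_eq_sum_single[of g] by simp
  also have "\<dots> = (\<Sum>u\<in>Poly_Mapping.keys f. \<Sum>v\<in>Poly_Mapping.keys g.
      mpoly_extend \<phi> (?s f u * ?s g v))"
    by (simp add: sum_product mpoly_extend_sum)
  also have "\<dots> = mpoly_extend \<phi> f * mpoly_extend \<phi> g"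
    by (simp add: mult_single mpoly_extend_single assms Const_simps sum_product
        mpoly_extend_def[of \<phi> f] mpoly_extend_def[of \<phi> g] algebra_simps)
  finally show ?thesis .
qed

lemma lookup_mpoly_extend_single:
  "Poly_Mapping.lookup (mpoly_extend (\<lambda>u. Poly_Mapping.single (T u) 1) f) \<alpha> =
     (\<Sum>u | u \<in> Poly_Mapping.keys f \<and> T u = \<alpha>. Poly_Mapping.lookup f u)"
  by (auto simp: mpoly_extend_def lookup_sum lookup_single when_def sum.If_cases Int_def)

subsection \<open>Degrees and the toric map on monomials\<close>

definition mdeg :: "monomial \<Rightarrow> nat" where
  "mdeg u = (\<Sum>i\<in>Poly_Mapping.keys u. Poly_Mapping.lookup u i)"

lemma mdeg_add [simp]: "mdeg (u + v) = mdeg u + mdeg v"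
  unfolding mdeg_def by (rule setsum_keys_plus_distrib) auto

lemma mdeg_zero [simp]: "mdeg 0 = 0"
  by (simp add: mdeg_def)

lemma mdeg_single [simp]: "mdeg (Poly_Mapping.single i a) = a"
  by (simp add: mdeg_def)

lemma mdeg_sum: "mdeg (sum f X) = (\<Sum>x\<in>X. mdeg (f x))"
  by (induction X rule: infinite_finite_induct) auto

lemma mdeg_eq_sum: "finite A \<Longrightarrow> Poly_Mapping.keys u \<subseteq> A \<Longrightarrow> mdeg u = (\<Sum>i\<in>A. Poly_Mapping.lookup u i)"
  unfolding mdeg_def by (rule sum.mono_neutral_left) (auto simp: in_keys_iff)

lemma lookup_le_mdeg: "Poly_Mapping.lookup u i \<le> mdeg u"
  unfolding mdeg_def
  by (cases "i \<in> Poly_Mapping.keys u") (auto intro: member_le_sum simp: in_keys_iff)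

lemma mdeg_eq_0D: "mdeg u = 0 \<Longrightarrow> u = 0"
  by (rule poly_mapping_eqI) (metis lookup_le_mdeg le_zero_eq lookup_zero)

text \<open>With u read as a multiset of edges, the entry at a vertex is its degree in that
  multiset. This is the exponent vector of the image of x^u under the toric map.\<close>

definition toric_exp :: "(nat \<Rightarrow> nat set) \<Rightarrow> monomial \<Rightarrow> monomial" where
  "toric_exp edge u =
     (\<Sum>i\<in>Poly_Mapping.keys u. \<Sum>v\<in>edge i. Poly_Mapping.single v (Poly_Mapping.lookup u i))"

lemma toric_exp_add [simp]: "toric_exp edge (u + v) = toric_exp edge u + toric_exp edge v"
  unfolding toric_exp_def by (rule setsum_keys_plus_distrib) (simp_all add: single_add sum.distrib)

lemma toric_exp_zero [simp]: "toric_exp edge 0 = 0"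
  by (simp add: toric_exp_def)

lemma toric_exp_single: "toric_exp edge (Poly_Mapping.single i a) = (\<Sum>v\<in>edge i. Poly_Mapping.single v a)"
  by (simp add: toric_exp_def)

lemma power_Var: "(Var v :: 'k::field mpoly) ^ a = Poly_Mapping.single (Poly_Mapping.single v a) 1"
  by (induction a) (simp_all add: Var_def mult_single flip: single_add)

lemma prod_single_one:
  "(\<Prod>x\<in>X. Poly_Mapping.single (f x) (1::'k::field)) = Poly_Mapping.single (\<Sum>x\<in>X. f x :: monomial) 1"
  by (induction X rule: infinite_finite_induct) (simp_all add: mult_single)

lemma toric_hom_eq:
  "(toric_hom edge :: 'k::field mpoly \<Rightarrow> _) = mpoly_extend (\<lambda>u. Poly_Mapping.single (toric_exp edge u) 1)"
  by (rule ext)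
    (simp add: toric_hom_def mpoly_extend_def prod_power_distrib power_Var prod_single_one toric_exp_def
      del: Const_times_single)

lemmas lookup_toric_hom = lookup_mpoly_extend_single[of "toric_exp edge" for edge, folded toric_hom_eq]

lemma toric_hom_single:
  "toric_hom edge (Poly_Mapping.single u c) = Poly_Mapping.single (toric_exp edge u) c"
  by (simp add: toric_hom_eq mpoly_extend_single)

lemma toric_hom_add: "toric_hom edge (f + g) = toric_hom edge f + toric_hom edge g"
  by (simp add: toric_hom_eq mpoly_extend_add)

lemma toric_hom_mult: "toric_hom edge (f * g) = toric_hom edge f * toric_hom edge g"
  unfolding toric_hom_eq by (rule mpoly_extend_mult) (simp add: mult_single)

lemma toric_hom_simps:
  fixes f g :: "'k::field mpoly"
  shows "toric_hom edge (0 :: 'k mpoly) = 0" "toric_hom edge (1 :: 'k mpoly) = 1" "toric_hom edge (- f) = - toric_hom edge f"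
  "toric_hom edge (f - g) = toric_hom edge f - toric_hom edge g"
proof -
  show z: "toric_hom edge (0 :: 'k mpoly) = 0" and "toric_hom edge (1 :: 'k mpoly) = 1"
    using toric_hom_single[of edge 0 "1 :: 'k"] by (simp_all add: toric_hom_eq)
  show d: "toric_hom edge (f - g) = toric_hom edge f - toric_hom edge g" for f g :: "'k mpoly"
    by (simp add: toric_hom_eq mpoly_extend_diff)
  show "toric_hom edge (- f) = - toric_hom edge f"
    using d[of 0 f] z by simp
qed

lemma toric_ideal_iff:
  "f \<in> toric_ideal m n edge \<longleftrightarrow> f \<in> carrier (mpoly_ring {1..n}) \<and> toric_hom edge f = 0"
  by (simp add: toric_ideal_def a_kernel_def')

lemma ideal_toric_ideal: "ideal (toric_ideal m n edge :: 'k::field mpoly set) (mpoly_ring {1..n})"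
  by (rule mpoly_idealI)
    (auto simp: toric_ideal_iff toric_hom_simps toric_hom_add toric_hom_mult intro: mpoly_ring_closed)

subsection \<open>Rewriting of monomials\<close>

text \<open>In each coordinate a or b vanishes, so the truncated difference r - b is the common
  cofactor. Coprimality of the z_C acts through this: it closes the critical pairs in the confluence
  proof, and in the count it makes divisibility by z_D independent of a factor z_C.\<close>

lemma coprime_monomials_merge:
  assumes "r + a = s + b" "coprime_monomials a b"
  shows "\<exists>q. r = q + b \<and> s = q + a"
proof (intro exI conjI poly_mapping_eqI)
  fix i
  have *: "Poly_Mapping.lookup r i + Poly_Mapping.lookup a i = Poly_Mapping.lookup s i + Poly_Mapping.lookup b i"
    using assms(1) by (metis lookup_add)
  have "Poly_Mapping.lookup a i = 0 \<or> Poly_Mapping.lookup b i = 0"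
    using assms(2) by (auto simp: coprime_monomials_def in_keys_iff)
  with * show "Poly_Mapping.lookup r i = Poly_Mapping.lookup (r - b + b) i"
    "Poly_Mapping.lookup s i = Poly_Mapping.lookup (r - b + a) i"
    by (auto simp: lookup_add lookup_minus)
qed

section \<open>Monomials of a fixed degree\<close>

definition monomials :: "nat \<Rightarrow> nat \<Rightarrow> monomial set" where
  "monomials n k = {u. Poly_Mapping.keys u \<subseteq> {1..n} \<and> mdeg u = k}"

text \<open>The index set is arbitrary, so that the count can run by induction on it.\<close>

definition normal_monomials :: "nat \<Rightarrow> 'i set \<Rightarrow> ('i \<Rightarrow> monomial) \<Rightarrow> nat \<Rightarrow> monomial set" where
  "normal_monomials n Z z k = {u \<in> monomials n k. \<forall>C\<in>Z. \<forall>r. u \<noteq> r + z C}"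

text \<open>Passing to lists of n naturals with sum k makes the stars-and-bars count
  \<open>card_length_sum_list\<close> applicable.\<close>

lemma bij_betw_monomials:
  "bij_betw (\<lambda>u. map (Poly_Mapping.lookup u) [1..<Suc n]) (monomials n k) {l. length l = n \<and> sum_list l = k}"
proof (rule bij_betwI')
  fix u v assume u: "u \<in> monomials n k" and v: "v \<in> monomials n k"
  show "(map (Poly_Mapping.lookup u) [1..<Suc n] = map (Poly_Mapping.lookup v) [1..<Suc n]) = (u = v)"
  proof
    assume "map (Poly_Mapping.lookup u) [1..<Suc n] = map (Poly_Mapping.lookup v) [1..<Suc n]"
    then have *: "Poly_Mapping.lookup u i = Poly_Mapping.lookup v i" if "i \<in> {1..n}" for i
      using that by (auto simp del: upt_Suc)
    show "u = v"
    proof (rule poly_mapping_eqI)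
      fix i
      show "Poly_Mapping.lookup u i = Poly_Mapping.lookup v i"
      proof (cases "i \<in> {1..n}")
        case False
        then have "i \<notin> Poly_Mapping.keys u" "i \<notin> Poly_Mapping.keys v"
          using u v unfolding monomials_def by blast+
        then show ?thesis by (simp add: in_keys_iff)
      qed (rule *)
    qed
  qed simp
next
  fix u assume u: "u \<in> monomials n k"
  have "sum_list (map (Poly_Mapping.lookup u) [1..<Suc n]) = (\<Sum>i\<in>{1..n}. Poly_Mapping.lookup u i)"
    by (simp add: sum_list_distinct_conv_sum_set atLeastLessThanSuc_atLeastAtMost del: upt_Suc)
  also have "\<dots> = k"
    using u mdeg_eq_sum[of "{1..n}" u] by (auto simp: monomials_def)
  finally show "map (Poly_Mapping.lookup u) [1..<Suc n] \<in> {l. length l = n \<and> sum_list l = k}"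
    by (simp del: upt_Suc)
next
  fix l :: "nat list" assume l: "l \<in> {l. length l = n \<and> sum_list l = k}"
  \<comment> \<open>The leading 0 fills position 0, since the variables are numbered from 1.\<close>
  define u where "u = Poly_Mapping.nth (0 # l)"
  have eq: "map (Poly_Mapping.lookup u) [1..<Suc n] = l"
    using l by (intro nth_equalityI) (simp_all add: u_def nth_default_def del: upt_Suc)
  have keys: "Poly_Mapping.keys u \<subseteq> {1..n}"
  proof
    fix i assume "i \<in> Poly_Mapping.keys u"
    then have "nth_default 0 (0 # l) i \<noteq> 0"
      by (simp add: u_def in_keys_iff del: keys_nth)
    then show "i \<in> {1..n}"
      using l by (cases i) (auto simp: nth_default_def split: if_splits)
  qed
  then have "mdeg u = (\<Sum>i\<in>{1..n}. Poly_Mapping.lookup u i)"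
    by (intro mdeg_eq_sum) auto
  also have "\<dots> = sum_list (map (Poly_Mapping.lookup u) [1..<Suc n])"
    by (simp add: sum_list_distinct_conv_sum_set atLeastLessThanSuc_atLeastAtMost del: upt_Suc)
  finally have "mdeg u = k"
    using l eq by simp
  with keys eq show "\<exists>u\<in>monomials n k. l = map (Poly_Mapping.lookup u) [1..<Suc n]"
    by (auto simp: monomials_def)
qed

lemma card_monomials: "card (monomials n k) = (k + n - 1) choose k"
  using bij_betw_same_card[OF bij_betw_monomials, of n k] by (simp add: card_length_sum_list)

lemma finite_monomials [simp]: "finite (monomials n k)"
proof -
  have "{l. length l = n \<and> sum_list l = k} \<subseteq> {l. set l \<subseteq> {..k} \<and> length l = n}"
    using member_le_sum_list by fastforce
  then have "finite {l. length l = n \<and> sum_list l = k}"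
    by (rule finite_subset) (rule finite_lists_length_eq, simp)
  then show ?thesis
    using bij_betw_finite[OF bij_betw_monomials] by blast
qed

section \<open>Confluence and termination of the rewriting\<close>

definition rewrite_step :: "'i set \<Rightarrow> ('i \<Rightarrow> monomial) \<Rightarrow> ('i \<Rightarrow> monomial) \<Rightarrow> monomial \<Rightarrow> monomial \<Rightarrow> bool" where
  "rewrite_step Z z w u v \<longleftrightarrow> (\<exists>C\<in>Z. \<exists>r. u = r + z C \<and> v = r + w C)"

text \<open>Coprime left-hand sides cannot overlap: after the rule of C has been applied, the factor
  z_D is still present, and vice versa. Two steps by different rules therefore commute, which is
  strong confluence.\<close>

lemma confluentp_rewrite_step:
  assumes "\<And>C D. C \<in> Z \<Longrightarrow> D \<in> Z \<Longrightarrow> C \<noteq> D \<Longrightarrow> coprime_monomials (z C) (z D)"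
  shows "confluentp (rewrite_step Z z w)"
proof (rule strong_confluentp_imp_confluentp, rule strong_confluentpI)
  fix x y y' assume "rewrite_step Z z w x y" "rewrite_step Z z w x y'"
  then obtain C D r s where CD: "C \<in> Z" "D \<in> Z" and x: "x = r + z C" "x = s + z D"
    and y: "y = r + w C" "y' = s + w D"
    unfolding rewrite_step_def by blast
  show "\<exists>u. (rewrite_step Z z w)\<^sup>*\<^sup>* y u \<and> (rewrite_step Z z w)\<^sup>=\<^sup>= y' u"
  proof (cases "C = D")
    case True
    then show ?thesis using x y by auto
  next
    case False
    then obtain q where "r = q + z D" "s = q + z C"
      using coprime_monomials_merge[of r "z C" s "z D"] assms[OF CD] x by auto
    then have "rewrite_step Z z w y (q + w C + w D)" "rewrite_step Z z w y' (q + w C + w D)"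
      using CD y unfolding rewrite_step_def by (metis add.assoc add.commute)+
    then show ?thesis by blast
  qed
qed

text \<open>Bookkeeping of the rules applied along a derivation. For a cycle, u = v cancels and
  leaves the equality of products that condition (b) forbids.\<close>

lemma rewrite_steps_sum_list:
  assumes "(rewrite_step Z z w)\<^sup>+\<^sup>+ u v"
  shows "\<exists>Cs. Cs \<noteq> [] \<and> set Cs \<subseteq> Z \<and> u + sum_list (map w Cs) = v + sum_list (map z Cs)"
  using assms
proof (induction rule: tranclp_induct)
  case (base v)
  then obtain C r where "C \<in> Z" "u = r + z C" "v = r + w C"
    unfolding rewrite_step_def by blast
  then show ?case
    by (intro exI[of _ "[C]"]) (simp add: ac_simps)
next
  case (step v v')
  then obtain Cs C r where Cs: "set Cs \<subseteq> Z" "u + sum_list (map w Cs) = v + sum_list (map z Cs)"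
    and C: "C \<in> Z" "v = r + z C" "v' = r + w C"
    unfolding rewrite_step_def by blast
  have "u + sum_list (map w (C # Cs)) = (u + sum_list (map w Cs)) + w C"
    by (simp add: ac_simps)
  also have "\<dots> = v' + sum_list (map z (C # Cs))"
    unfolding Cs(2) C by (simp add: ac_simps)
  finally show ?case
    using Cs(1) C(1) by (intro exI[of _ "C # Cs"]) simp
qed

text \<open>Steps preserve the degree, so derivations from u stay in the finite set of monomials of
  degree k. On a finite set termination can fail only through a cycle, and
  \<open>rewrite_steps_sum_list\<close> turns a cycle into a violation of condition (b).\<close>

lemma ex_normal_monomial:
  assumes acyclic: "\<And>Cs. Cs \<noteq> [] \<Longrightarrow> set Cs \<subseteq> Z \<Longrightarrow> sum_list (map w Cs) \<noteq> sum_list (map z Cs)"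
    and w: "\<And>C. C \<in> Z \<Longrightarrow> Poly_Mapping.keys (w C) \<subseteq> {1..n} \<and> mdeg (w C) = mdeg (z C)"
    and u: "u \<in> monomials n k"
  shows "\<exists>v\<in>normal_monomials n Z z k. (rewrite_step Z z w)\<^sup>*\<^sup>* u v"
proof -
  define S where "S = {(v, u). u \<in> monomials n k \<and> rewrite_step Z z w u v}"
  have closed: "v \<in> monomials n k" if "u \<in> monomials n k" "rewrite_step Z z w u v" for u v
    using that w unfolding rewrite_step_def monomials_def by fastforce
  have "S \<subseteq> monomials n k \<times> monomials n k"
    using closed by (auto simp: S_def)
  then have "finite S"
    by (rule finite_subset) simp
  moreover have "acyclic S"
    unfolding acyclic_def
  proof safe
    fix u assume "(u, u) \<in> S\<^sup>+"
    moreover have "(rewrite_step Z z w)\<^sup>+\<^sup>+ v u" if "(u, v) \<in> S\<^sup>+" for u v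
      using that by (induction rule: trancl_induct) (auto simp: S_def intro: tranclp_into_tranclp2)
    ultimately show False
      using rewrite_steps_sum_list[of Z z w u u] acyclic by auto
  qed
  ultimately have "wf S"
    by (rule finite_acyclic_wf)
  from this u show ?thesis
  proof (induction u rule: wf_induct_rule)
    case (less u)
    show ?case
    proof (cases "\<exists>v. rewrite_step Z z w u v")
      case True
      then obtain v where v: "rewrite_step Z z w u v" by blast
      then obtain v' where "v' \<in> normal_monomials n Z z k" "(rewrite_step Z z w)\<^sup>*\<^sup>* v v'"
        using less.IH[of v] less.prems closed[of u v] by (auto simp: S_def)
      with v show ?thesis
        by (meson converse_rtranclp_into_rtranclp)
    next
      case False
      then have "u \<in> normal_monomials n Z z k"
        using less.prems by (auto simp: normal_monomials_def rewrite_step_def)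
      then show ?thesis by blast
    qed
  qed
qed

text \<open>By confluence convertible monomials have a common reduct, and a monomial that admits no
  step is its own only reduct.\<close>

lemma normal_monomial_unique:
  assumes "\<And>C D. C \<in> Z \<Longrightarrow> D \<in> Z \<Longrightarrow> C \<noteq> D \<Longrightarrow> coprime_monomials (z C) (z D)"
    and uv: "u \<in> normal_monomials n Z z k" "v \<in> normal_monomials n Z z l"
    and eq: "equivclp (rewrite_step Z z w) u v"
  shows "u = v"
proof -
  have "semiconfluentp (rewrite_step Z z w)"
    unfolding confluentp_eq_semiconfluentp[symmetric]
    by (rule confluentp_rewrite_step) (rule assms(1))
  from semiconfluentp_equivclp[OF this] eq
  have "((rewrite_step Z z w)\<^sup>*\<^sup>* OO (rewrite_step Z z w)\<inverse>\<inverse>\<^sup>*\<^sup>*) u v"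
    by metis
  then obtain x where x: "(rewrite_step Z z w)\<^sup>*\<^sup>* u x" "(rewrite_step Z z w)\<^sup>*\<^sup>* v x"
    unfolding rtranclp_conversep by blast
  have normal: "\<not> rewrite_step Z z w u y" "\<not> rewrite_step Z z w v y" for y
    using uv unfolding normal_monomials_def rewrite_step_def by blast+
  from x(1) normal(1) have "x = u"
    by (cases rule: converse_rtranclpE) blast+
  moreover from x(2) normal(2) have "x = v"
    by (cases rule: converse_rtranclpE) blast+
  ultimately show ?thesis by simp
qed

subsection \<open>The number of normal monomials\<close>

text \<open>Pascal's rule, arranged as the recursion that arises when one more z_C is added: h r
  will be the number of monomials of degree k - 2 r, and the shift to h (Suc r) accounts for
  dividing by z_C.\<close>

lemma alternating_binomial_Suc:
  fixes h :: "nat \<Rightarrow> real"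
  shows "(\<Sum>r = 0..Suc p. (-1) ^ r * real (Suc p choose r) * h r) =
    (\<Sum>r = 0..p. (-1) ^ r * real (p choose r) * h r) - (\<Sum>r = 0..p. (-1) ^ r * real (p choose r) * h (Suc r))"
proof -
  have "(\<Sum>r = 0..Suc p. (-1) ^ r * real (Suc p choose r) * h r) =
     h 0 + (\<Sum>r = 0..p. (-1) ^ Suc r * real (p choose Suc r) * h (Suc r)) 
       - (\<Sum>r = 0..p. (-1) ^ r * real (p choose r) * h (Suc r))"
    by (subst sum.atLeast0_atMost_Suc_shift) (simp add: algebra_simps sum.distrib sum_negf sum_subtractf)
  also have "h 0 + (\<Sum>r = 0..p. (-1) ^ Suc r * real (p choose Suc r) * h (Suc r)) =
     (\<Sum>r = 0..Suc p. (-1) ^ r * real (p choose r) * h r)"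
    by (simp add: sum.atLeast0_atMost_Suc_shift del: sum.cl_ivl_Suc)
  also have "\<dots> = (\<Sum>r = 0..p. (-1) ^ r * real (p choose r) * h r)"
    by simp
  finally show ?thesis .
qed

text \<open>Inclusion-exclusion as an induction on Z: among the monomials normal for Z, those
  divisible by a new z_C are exactly the products r z_C with r normal for Z of degree k - 2, because
  z_C is coprime to the other z_D. The lower bound on k keeps every k - 2 r from being
  truncated.\<close>

lemma card_normal_monomials:
  assumes "finite Z"
    and "\<And>C. C \<in> Z \<Longrightarrow> Poly_Mapping.keys (z C) \<subseteq> {1..n} \<and> mdeg (z C) = 2"
    and "\<And>C D. C \<in> Z \<Longrightarrow> D \<in> Z \<Longrightarrow> C \<noteq> D \<Longrightarrow> coprime_monomials (z C) (z D)"
    and "k \<ge> 2 * card Z"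
  shows "real (card (normal_monomials n Z z k)) =
    (\<Sum>r = 0..card Z. (-1) ^ r * real (card Z choose r) * real (card (monomials n (k - 2 * r))))"
  using assms
proof (induction Z arbitrary: k)
  case empty
  then show ?case by (simp add: normal_monomials_def)
next
  case (insert C Z)
  let ?N = "normal_monomials n Z z"
  have inj: "inj_on (\<lambda>r. r + z C) (?N (k - 2))"
    by (auto simp: inj_on_def)
  have "?N k = normal_monomials n (insert C Z) z k \<union> (\<lambda>r. r + z C) ` ?N (k - 2)"
  proof (intro equalityI subsetI)
    fix u assume u: "u \<in> ?N k"
    show "u \<in> normal_monomials n (insert C Z) z k \<union> (\<lambda>r. r + z C) ` ?N (k - 2)"
    proof (cases "\<exists>r. u = r + z C")
      case True
      then obtain r where r: "u = r + z C" by blast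
      have "r \<in> ?N (k - 2)"
        using u insert.prems(1)[of C] unfolding r normal_monomials_def monomials_def
        by (auto simp: add.assoc add.commute[of _ "z C"]) (metis add.assoc add.commute)
      then show ?thesis using r by blast
    next
      case False
      then show ?thesis using u by (auto simp: normal_monomials_def)
    qed
  next
    fix u assume "u \<in> normal_monomials n (insert C Z) z k \<union> (\<lambda>r. r + z C) ` ?N (k - 2)"
    then show "u \<in> ?N k"
    proof
      assume "u \<in> (\<lambda>r. r + z C) ` ?N (k - 2)"
      then obtain r where r: "r \<in> ?N (k - 2)" "u = r + z C" by blast
      have "r + z C \<noteq> s + z D" if "D \<in> Z" for D s
      proof
        assume "r + z C = s + z D"
        moreover have "coprime_monomials (z C) (z D)"
          using insert.prems(2)[of C D] insert.hyps that by auto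
        ultimately obtain q where "r = q + z D"
          using coprime_monomials_merge by blast
        with r that show False by (auto simp: normal_monomials_def)
      qed
      moreover have "k \<ge> 2"
        using insert.prems(3) insert.hyps by simp
      ultimately show ?thesis
        using r insert.prems(1)[of C] by (auto simp: normal_monomials_def monomials_def)
    qed (auto simp: normal_monomials_def)
  qed
  moreover have "normal_monomials n (insert C Z) z k \<inter> (\<lambda>r. r + z C) ` ?N (k - 2) = {}"
    by (auto simp: normal_monomials_def)
  moreover have fin: "finite (normal_monomials n Y z j)" for Y j
    by (rule finite_subset[OF _ finite_monomials[of n j]]) (auto simp: normal_monomials_def)
  ultimately have "card (?N k) = card (normal_monomials n (insert C Z) z k) + card (?N (k - 2))"
    by (simp add: card_Un_disjoint card_image[OF inj])
  moreover have "real (card (?N j)) =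
      (\<Sum>r = 0..card Z. (-1) ^ r * real (card Z choose r) * real (card (monomials n (j - 2 * r))))"
    if "j \<ge> 2 * card Z" for j
    using insert.IH[of j] insert.prems that by auto
  note this[of k] this[of "k - 2"]
  ultimately show ?case
    using insert.prems(3) insert.hyps
    by (simp add: alternating_binomial_Suc del: sum.cl_ivl_Suc)
qed

text \<open>The linear polynomial is x = k - 2r. The Stirling numbers are the coefficients of the
  rising factorial x(x+1)...(x+n-1), whose quotient by x (n-1)! counts the monomials of degree x in
  n variables.\<close>

definition hilbert_poly :: "nat \<Rightarrow> nat \<Rightarrow> real poly" where
  "hilbert_poly n p = (\<Sum>r = 0..p. Polynomial.smult ((-1) ^ r * real (p choose r) / fact (n - 1))
     (\<Sum>l = 1..n. Polynomial.smult (real (stirling n l)) ([:- 2 * real r, 1:] ^ (l - 1))))"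

lemma card_monomials_stirling:
  assumes "n \<ge> 1" "x \<ge> 1"
  shows "real (card (monomials n x)) = (\<Sum>l = 1..n. real (stirling n l) * real x ^ (l - 1)) / fact (n - 1)"
proof -
  \<comment> \<open>For n >= 1 the rising factorial has no constant term, which permits the division
    by x and the start of the sum at l = 1.\<close>
  have st0: "stirling n 0 = 0"
    using assms by (cases n) auto
  have "real x * (\<Sum>l = 1..n. real (stirling n l) * real x ^ (l - 1)) =
      (\<Sum>l = 1..n. real (stirling n l) * real x ^ l)"
    by (auto simp: sum_distrib_left power_eq_if intro!: sum.cong)
  also have "\<dots> = (\<Sum>l\<le>n. real (stirling n l) * real x ^ l)"
    using st0 by (intro sum.mono_neutral_left) (auto simp: Suc_le_eq)
  also have "\<dots> = pochhammer (real x) n"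
    by (rule stirling_pochhammer)
  finally have 1: "real x * (\<Sum>l = 1..n. real (stirling n l) * real x ^ (l - 1)) = pochhammer (real x) n" .
  have "fact (x + n - 1) = (pochhammer 1 (x - 1 + n) :: real)"
    using assms by (simp add: pochhammer_fact)
  also have "\<dots> = fact (x - 1) * pochhammer (real x) n"
    using assms pochhammer_product'[of "1 :: real" "x - 1" n] by (simp add: pochhammer_fact of_nat_diff)
  finally have 2: "fact (x + n - 1) = fact (x - 1) * pochhammer (real x) n" .
  have "(fact x :: real) = real x * fact (x - 1)"
    using assms by (simp add: fact_reduce)
  moreover have "real (card (monomials n x)) = fact (x + n - 1) / (fact x * fact (n - 1))"
    using assms by (simp add: card_monomials binomial_fact)
  ultimately have "real (card (monomials n x)) =
      (fact (x - 1) * (real x * (\<Sum>l = 1..n. real (stirling n l) * real x ^ (l - 1)))) /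
      (real x * fact (x - 1) * fact (n - 1))"
    unfolding 1 2 by simp
  then show ?thesis
    using assms by simp
qed

text \<open>The strict bound on k makes every degree k - 2 r with r <= p positive, so truncated
  subtraction agrees with the real one and \<open>card_monomials_stirling\<close> applies.\<close>

lemma poly_hilbert_poly:
  assumes "n \<ge> 1" "k > 2 * p"
  shows "poly (hilbert_poly n p) (real k) =
    (\<Sum>r = 0..p. (-1) ^ r * real (p choose r) * real (card (monomials n (k - 2 * r))))"
proof -
  have "poly (hilbert_poly n p) (real k) = (\<Sum>r = 0..p. (-1) ^ r * real (p choose r) *
      ((\<Sum>l = 1..n. real (stirling n l) * real (k - 2 * r) ^ (l - 1)) / fact (n - 1)))"
    unfolding hilbert_poly_def poly_sum
  proof (rule sum.cong[OF refl])
    fix r assume "r \<in> {0..p}"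
    then have "real (k - 2 * r) = real k - 2 * real r"
      using assms by (simp add: of_nat_diff)
    then show "poly (Polynomial.smult ((-1) ^ r * real (p choose r) / fact (n - 1))
          (\<Sum>l = 1..n. Polynomial.smult (real (stirling n l)) ([:- 2 * real r, 1:] ^ (l - 1)))) (real k) =
        (-1) ^ r * real (p choose r) *
          ((\<Sum>l = 1..n. real (stirling n l) * real (k - 2 * r) ^ (l - 1)) / fact (n - 1))"
      by (simp add: poly_sum poly_power)
  qed
  also have "\<dots> = (\<Sum>r = 0..p. (-1) ^ r * real (p choose r) * real (card (monomials n (k - 2 * r))))"
    using assms by (intro sum.cong refl) (subst card_monomials_stirling, auto)
  finally show ?thesis .
qed

text \<open>Put l = m - 1 + i in the expansion of (k - 2r)^(l-1); powers with l < m - 1 have too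
  small a degree to contribute. The upper limit is written n + 1 - m because on naturals n - m + 1
  would be 1 instead of 0 when n = m - 1, the case of a tree.\<close>

lemma coeff_hilbert_poly:
  assumes "n \<ge> 1" "m \<ge> 2"
  shows "Polynomial.coeff (hilbert_poly n p) (m - 2) = 1 / fact (n - 1) *
     (\<Sum>r = 0..p. (- 1) ^ r * real (p choose r) *
        (\<Sum>i = 0..n + 1 - m. (- 1) ^ i * real (stirling n (m + i - 1)) *
           real ((m + i - 2) choose i) * (2 * real r) ^ i))"
proof -
  have "(\<Sum>l = 1..n. real (stirling n l) * Polynomial.coeff ([:- 2 * real r, 1:] ^ (l - 1)) (m - 2)) =
      (\<Sum>i = 0..n + 1 - m. (- 1) ^ i * real (stirling n (m + i - 1)) *
           real ((m + i - 2) choose i) * (2 * real r) ^ i)" for r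
  proof (cases "n + 1 < m")
    \<comment> \<open>Here n + 1 - m truncates to 0, and the single remaining term contains
      \<open>stirling n (m - 1)\<close>, which is 0; both sides vanish.\<close>
    case True
    have "Polynomial.coeff ([:- 2 * real r, 1:] ^ (l - 1)) (m - 2) = 0" if "l \<in> {1..n}" for l
    proof -
      have "l - 1 < m - 2"
        using that True unfolding atLeastAtMost_iff by arith
      then show ?thesis
        by (intro coeff_eq_0) (simp add: degree_linear_power)
    qed
    moreover have "stirling n (m - 1) = 0" "n + 1 - m = 0"
      using True by (auto simp: less_diff_conv)
    ultimately show ?thesis
      by simp
  next
    case False
    have "(\<Sum>l = 1..n. real (stirling n l) * Polynomial.coeff ([:- 2 * real r, 1:] ^ (l - 1)) (m - 2)) =
       (\<Sum>l = m - 1..n. real (stirling n l) * Polynomial.coeff ([:- 2 * real r, 1:] ^ (l - 1)) (m - 2))"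
      using assms False
      by (intro sum.mono_neutral_right) (auto simp: coeff_eq_0 degree_linear_power)
    also have "\<dots> = (\<Sum>l = 0 + (m - 1)..(n + 1 - m) + (m - 1).
        real (stirling n l) * Polynomial.coeff ([:- 2 * real r, 1:] ^ (l - 1)) (m - 2))"
      using assms False by (intro sum.cong) auto
    also have "\<dots> = (\<Sum>i = 0..n + 1 - m. (- 1) ^ i * real (stirling n (m + i - 1)) *
           real ((m + i - 2) choose i) * (2 * real r) ^ i)"
      unfolding sum.shift_bounds_cl_nat_ivl
    proof (rule sum.cong[OF refl])
      fix i
      have eq: "i + (m - 1) - 1 = m + i - 2" "m + i - 1 = i + (m - 1)" "Suc (Suc (m - 2)) = m"
        using assms by auto
      have "(m + i - 2) choose (m - 2) = (m + i - 2) choose i"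
        using assms binomial_symmetric[of i "m + i - 2"] by simp
      moreover have "(- 2 * real r) ^ i = (- 1) ^ i * (2 * real r) ^ i"
        using power_minus[of "2 * real r" i] by simp
      ultimately show "real (stirling n (i + (m - 1))) *
          Polynomial.coeff ([:- 2 * real r, 1:] ^ (i + (m - 1) - 1)) (m - 2) =
          (- 1) ^ i * real (stirling n (m + i - 1)) * real ((m + i - 2) choose i) * (2 * real r) ^ i"
        unfolding eq by (subst coeff_linear_poly_power) (simp_all add: eq)
    qed
    finally show ?thesis .
  qed
  then show ?thesis
    by (simp add: hilbert_poly_def coeff_sum sum_distrib_left)
qed

subsection \<open>Quadratic binomials and four-cycles\<close>

lemma lookup_toric_exp_single:
  "finite (edge i) \<Longrightarrow>
    Poly_Mapping.lookup (toric_exp edge (Poly_Mapping.single i a)) v = (if v \<in> edge i then a else 0)"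
  by (simp add: toric_exp_single lookup_sum lookup_single when_def)

lemma mdeg_toric_exp:
  assumes "\<And>i. i \<in> Poly_Mapping.keys u \<Longrightarrow> card (edge i) = 2"
  shows "mdeg (toric_exp edge u) = 2 * mdeg u"
  using assms by (simp add: toric_exp_def mdeg_sum mdeg_def[of u] sum_distrib_left)

lemma Var_mult: "Var a * Var b = (Poly_Mapping.single (Poly_Mapping.single a 1 + Poly_Mapping.single b 1) 1 :: 'k::field mpoly)"
  by (simp add: Var_def mult_single)

lemma consecutive_edges_Int:
  assumes "consecutive_edges n edge a b c d"
  shows "edge a \<inter> edge c = {}" "edge b \<inter> edge d = {}" "edge a \<inter> edge b \<noteq> {}"
    "edge b \<inter> edge c \<noteq> {}" "edge c \<inter> edge d \<noteq> {}" "edge d \<inter> edge a \<noteq> {}"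
    "distinct [a, b, c, d]"
proof -
  obtain v1 v2 v3 v4 where v: "distinct [v1, v2, v3, v4]" "edge a = {v1, v2}" "edge b = {v2, v3}"
    "edge c = {v3, v4}" "edge d = {v4, v1}"
    using assms unfolding consecutive_edges_def by blast
  then show "edge a \<inter> edge c = {}" "edge b \<inter> edge d = {}" "edge a \<inter> edge b \<noteq> {}"
    "edge b \<inter> edge c \<noteq> {}" "edge c \<inter> edge d \<noteq> {}" "edge d \<inter> edge a \<noteq> {}"
    by auto
  have "edge a \<noteq> edge b" "edge a \<noteq> edge c" "edge a \<noteq> edge d" "edge b \<noteq> edge c" "edge b \<noteq> edge d"
    "edge c \<noteq> edge d"
    using v(1) unfolding v(2-) by (auto simp: doubleton_eq_iff)
  then show "distinct [a, b, c, d]" by auto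
qed

text \<open>Cycles are indexed by their edge sets, but one set has several enumerations as
  consecutive edges. Among the edges of a 4-cycle the opposite ones are exactly the disjoint pairs,
  so all enumerations yield the same two diagonals and hence the same two monomials.\<close>

lemma four_cycle_diagonals:
  assumes "consecutive_edges n edge a c b d" "consecutive_edges n edge a' b' c' d'"
    and "{a, c, b, d} = {a', b', c', d'}"
  shows "{a', c'} = {a, b} \<and> {b', d'} = {c, d} \<or> {a', c'} = {c, d} \<and> {b', d'} = {a, b}"
proof -
  note i = consecutive_edges_Int[OF assms(1)] and j = consecutive_edges_Int[OF assms(2)]
  have opposite: "{x, y} = {a, b} \<or> {x, y} = {c, d}"
    if x: "x \<in> {a, c, b, d}" and y: "y \<in> {a, c, b, d}" and xy: "edge x \<inter> edge y = {}" for x y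
  proof -
    have "edge a \<noteq> {}" "edge b \<noteq> {}" "edge c \<noteq> {}" "edge d \<noteq> {}"
      using i(3-6) by blast+
    moreover have "edge c \<inter> edge a \<noteq> {}" "edge b \<inter> edge c \<noteq> {}" "edge d \<inter> edge b \<noteq> {}" "edge a \<inter> edge d \<noteq> {}"
      using i(3-6) by blast+
    ultimately have "(x, y) \<in> {(a, b), (b, a), (c, d), (d, c)}"
      using x y xy i(3-6) unfolding insert_iff empty_iff by (elim disjE) simp_all
    then show ?thesis by auto
  qed
  have "{a', c'} = {a, b} \<or> {a', c'} = {c, d}"
    using j(1) assms(3) by (intro opposite) auto
  moreover have "{b', d'} = {a, b} \<or> {b', d'} = {c, d}"
    using j(2) assms(3) by (intro opposite) auto
  moreover have "{a', c'} \<inter> {b', d'} = {}"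
    using j(7) by auto
  ultimately show ?thesis by (metis Int_absorb insert_not_empty)
qed

text \<open>The enumeration a, c, b, d makes a, b opposite and c, d opposite, as in the binomial x_a
  x_b - x_c x_d. Such a binomial is thereby f_C up to sign, whichever way the choice for C was
  made.\<close>

lemma admissible_choice_cases:
  assumes ac: "admissible_choice n edge z w" and con: "consecutive_edges n edge a c b d"
  defines "C \<equiv> {a, c, b, d}"
  defines "s \<equiv> Poly_Mapping.single a 1 + Poly_Mapping.single b 1"
    and "t \<equiv> Poly_Mapping.single c 1 + Poly_Mapping.single d 1"
  shows "C \<in> four_cycles n edge" "z C = s \<and> w C = t \<or> z C = t \<and> w C = s"
proof -
  show C: "C \<in> four_cycles n edge"
    using con unfolding four_cycles_def C_def by blast
  obtain a' b' c' d' where 1: "consecutive_edges n edge a' b' c' d'" "C = {a', b', c', d'}"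
    "z C = Poly_Mapping.single a' 1 + Poly_Mapping.single c' 1"
    "w C = Poly_Mapping.single b' 1 + Poly_Mapping.single d' 1"
    using bspec[OF ac[unfolded admissible_choice_def] C] by (elim exE conjE) (rule that)
  have "{a', c'} = {a, b} \<and> {b', d'} = {c, d} \<or> {a', c'} = {c, d} \<and> {b', d'} = {a, b}"
    using four_cycle_diagonals[OF con 1(1)] 1(2) unfolding C_def by simp
  then show "z C = s \<and> w C = t \<or> z C = t \<and> w C = s"
    unfolding 1(3,4) s_def t_def by (auto simp: doubleton_eq_iff add.commute)
qed

lemma four_cycle_exponents:
  assumes "admissible_choice n edge z w" "C \<in> four_cycles n edge"
  shows "Poly_Mapping.keys (z C) \<subseteq> {1..n}" "Poly_Mapping.keys (w C) \<subseteq> {1..n}"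
    "mdeg (z C) = 2" "mdeg (w C) = 2" "toric_exp edge (z C) = toric_exp edge (w C)"
proof -
  obtain a b c d where con: "consecutive_edges n edge a b c d"
    and z: "z C = Poly_Mapping.single a 1 + Poly_Mapping.single c 1"
    and w: "w C = Poly_Mapping.single b 1 + Poly_Mapping.single d 1"
    using bspec[OF assms(1)[unfolded admissible_choice_def] assms(2)] by (elim exE conjE) (rule that)
  show "Poly_Mapping.keys (z C) \<subseteq> {1..n}" "Poly_Mapping.keys (w C) \<subseteq> {1..n}"
    using con by (auto simp: z w consecutive_edges_def)
  show "mdeg (z C) = 2" "mdeg (w C) = 2"
    by (simp_all add: z w)
  show "toric_exp edge (z C) = toric_exp edge (w C)"
    using con unfolding z w toric_exp_add toric_exp_single consecutive_edges_def
    by (auto simp: ac_simps)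
qed

text \<open>The edges e_a, e_b cover every vertex as often as e_c, e_d do. If e_a were e_c or e_d,
  cancelling it would make the two monomials equal. So each of e_c, e_d contains exactly one end of
  e_a, and their other ends are the two ends of e_b; the four edges close up to a 4-cycle.\<close>

lemma quadratic_binomial_consecutive:
  fixes edge :: "nat \<Rightarrow> nat set"
  assumes simple: "simple_graph m n edge" and abcd: "{a, b, c, d} \<subseteq> {1..n}"
    and ne: "Poly_Mapping.single a (1::nat) + Poly_Mapping.single b 1 \<noteq> Poly_Mapping.single c 1 + Poly_Mapping.single d 1"
    and eq: "toric_exp edge (Poly_Mapping.single a 1 + Poly_Mapping.single b 1) =
      toric_exp edge (Poly_Mapping.single c 1 + Poly_Mapping.single d 1)"
  shows "consecutive_edges n edge a c b d \<or> consecutive_edges n edge a d b c"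
proof -
  have card2: "card (edge a) = 2" "card (edge b) = 2" "card (edge c) = 2" "card (edge d) = 2"
    using simple abcd by (auto simp: simple_graph_def)
  then have fin: "finite (edge a)" "finite (edge b)" "finite (edge c)" "finite (edge d)"
    by (simp_all add: card_ge_0_finite)
  have inj: "edge i = edge j \<Longrightarrow> i = j" if "i \<in> {a, b, c, d}" "j \<in> {a, b, c, d}" for i j
    using simple abcd that unfolding simple_graph_def inj_on_def by blast
  have ind: "(if v \<in> edge a then 1 else 0) + (if v \<in> edge b then 1 else 0) =
      (if v \<in> edge c then 1 else 0) + (if v \<in> edge d then 1 else (0::nat))" for v
    using arg_cong[OF eq, of "\<lambda>t. Poly_Mapping.lookup t v"]
    unfolding toric_exp_add lookup_add by (simp only: lookup_toric_exp_single fin)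
  have ac: "edge a \<noteq> edge c"
  proof
    assume e: "edge a = edge c"
    have "v \<in> edge b \<longleftrightarrow> v \<in> edge d" for v
      using ind[of v] e by (auto split: if_splits)
    then have "edge b = edge d" by blast
    with e ne show False using inj[of a c] inj[of b d] by auto
  qed
  have ad: "edge a \<noteq> edge d"
  proof
    assume e: "edge a = edge d"
    have "v \<in> edge b \<longleftrightarrow> v \<in> edge c" for v
      using ind[of v] e by (auto split: if_splits)
    then have "edge b = edge c" by blast
    with e ne show False using inj[of a d] inj[of b c] by (auto simp: add.commute)
  qed
  have pair: "S = {p, q}" if "card S = 2" "p \<in> S" "q \<in> S" "p \<noteq> q" for S and p q :: nat
    using that by (auto simp: card_2_iff)
  have other: "\<exists>q. S = {p, q} \<and> q \<noteq> p" if "card S = 2" "p \<in> S" for S and p :: nat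
    using that by (auto simp: card_2_iff)
  \<comment> \<open>Stated for c', d' in either order: which of the edges e_c, e_d contains which
    end of e_a decides between the two disjuncts.\<close>
  have main: "consecutive_edges n edge a c' b d'"
    if x: "edge a = {x, y}" "x \<noteq> y" "x \<in> edge c'" "y \<in> edge d'" and cd: "{c', d'} = {c, d}"
      and ind: "\<And>v. (if v \<in> edge a then 1 else 0) + (if v \<in> edge b then 1 else 0) =
        (if v \<in> edge c' then 1 else 0) + (if v \<in> edge d' then 1 else (0::nat))"
    for c' d' x y
  proof -
    have "card (edge c') = 2" "card (edge d') = 2" "edge a \<noteq> edge c'" "edge a \<noteq> edge d'"
      using cd card2 ac ad by (auto simp: doubleton_eq_iff)
    note c' = this
    have "y \<notin> edge c'" "x \<notin> edge d'"
      using pair[of "edge c'" x y] pair[of "edge d'" x y] x c' by auto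
    obtain s t where s: "edge c' = {x, s}" "s \<noteq> x" and t: "edge d' = {y, t}" "t \<noteq> y"
      using other[of "edge c'" x] other[of "edge d'" y] x c' by auto
    have "s \<noteq> y" "t \<noteq> x"
      using s t \<open>y \<notin> edge c'\<close> \<open>x \<notin> edge d'\<close> by auto
    \<comment> \<open>Counting at s and at t: e_a misses both vertices, so e_b must supply
      them.\<close>
    have "s \<in> edge b" "s \<notin> edge d'" "t \<in> edge b"
      using ind[of s] ind[of t] s t x \<open>s \<noteq> y\<close> \<open>t \<noteq> x\<close> by (auto split: if_splits)
    then have st: "edge b = {s, t}" "s \<noteq> t"
      using pair[of "edge b" s t] card2 t by auto
    have "{a, c', b, d'} \<subseteq> {1..n}"
      using abcd cd by (auto simp: doubleton_eq_iff)
    moreover have "distinct [y, x, s, t] \<and> edge a = {y, x} \<and> edge c' = {x, s} \<and> edge b = {s, t} \<and> edge d' = {t, y}"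
      using x(1,2) s t \<open>s \<noteq> y\<close> \<open>t \<noteq> x\<close> st
      by (simp add: insert_commute)
    ultimately show ?thesis
      unfolding consecutive_edges_def by blast
  qed
  obtain x y where xy: "edge a = {x, y}" "x \<noteq> y"
    using card2(1) by (auto simp: card_2_iff)
  have x: "x \<in> edge c \<or> x \<in> edge d" and y: "y \<in> edge c \<or> y \<in> edge d"
    using ind[of x] ind[of y] xy by (auto split: if_splits)
  have "\<not> (x \<in> edge c \<and> y \<in> edge c)" "\<not> (x \<in> edge d \<and> y \<in> edge d)"
    using pair[of "edge c" x y] pair[of "edge d" x y] xy card2 ac ad by auto
  with x y consider "x \<in> edge c" "y \<in> edge d" | "x \<in> edge d" "y \<in> edge c" by blast
  then show ?thesis
  proof cases
    case 1
    then show ?thesis using main[OF xy, of c d] ind by auto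
  next
    case 2
    then show ?thesis using main[OF xy, of d c] ind by (simp add: insert_commute add.commute)
  qed
qed

subsection \<open>Fibres of the toric map\<close>

lemma single_one_inject:
  "Poly_Mapping.single u (1::'a::zero_neq_one) = Poly_Mapping.single v 1 \<longleftrightarrow> u = v"
  by (metis lookup_single_eq lookup_single_not_eq zero_neq_one)

lemma mpoly_mult_sum:
  fixes f g :: "'k::field mpoly"
  shows "g * f = (\<Sum>u\<in>Poly_Mapping.keys g. \<Sum>v\<in>Poly_Mapping.keys f.
     Poly_Mapping.single u (Poly_Mapping.lookup g u) * Poly_Mapping.single v (Poly_Mapping.lookup f v))"
  using arg_cong2[OF mpoly_eq_sum_single[of g] mpoly_eq_sum_single[of f], of "(*)"]
  by (simp only: sum_product)

text \<open>A substitute for multiplicativity of L: it is enough to make the kernel of L closed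
  under multiplication by arbitrary polynomials.\<close>

lemma mpoly_extend_mult_absorb:
  fixes f g :: "'k::field mpoly"
  assumes "\<And>u v. \<rho> (u + \<rho> v) = \<rho> (u + v)"
  defines "L \<equiv> mpoly_extend (\<lambda>u. Poly_Mapping.single (\<rho> u) (1::'k))"
  shows "L (g * f) = L (g * L f)"
proof -
  let ?s = "\<lambda>f u. Poly_Mapping.single u (Poly_Mapping.lookup (f :: 'k mpoly) u)"
  have "g * f = (\<Sum>u\<in>Poly_Mapping.keys g. \<Sum>v\<in>Poly_Mapping.keys f. ?s g u * ?s f v)"
    by (rule mpoly_mult_sum)
  moreover have "g * L f = (\<Sum>u\<in>Poly_Mapping.keys g. \<Sum>v\<in>Poly_Mapping.keys f.
      ?s g u * Poly_Mapping.single (\<rho> v) (Poly_Mapping.lookup f v))"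
    by (subst mpoly_eq_sum_single[of g]) (simp add: L_def mpoly_extend_def sum_product)
  ultimately show ?thesis
    using assms(1) by (simp add: L_def mpoly_extend_sum mult_single mpoly_extend_single)
qed

text \<open>For u and v with equal toric image the difference x^u - x^v lies in I(G), hence in the
  kernel J of the collapse L. So u and v have the same representative, that is, they are
  convertible.\<close>

lemma toric_exp_eq_imp_rewrite:
  assumes simple: "simple_graph m n edge"
    and gen: "generated_by_quadratic_binomials n (toric_ideal m n edge :: 'k::field mpoly set)"
    and ac: "admissible_choice n edge z w"
    and u: "Poly_Mapping.keys u \<subseteq> {1..n}" and v: "Poly_Mapping.keys v \<subseteq> {1..n}"
    and eq: "toric_exp edge u = toric_exp edge v"
  shows "equivclp (rewrite_step (four_cycles n edge) z w) u v"
proof -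
  define E where "E = equivclp (rewrite_step (four_cycles n edge) z w)"
  have E: "equivp E"
    unfolding E_def by (rule equivp_evquivclp)
  have Eadd: "E (t + a) (t + b)" if "E a b" for t a b
    using that unfolding E_def
  proof (induction rule: equivclp_induct)
    case base
    show ?case by simp
  next
    case (step y x)
    have "rewrite_step (four_cycles n edge) z w (t + p) (t + q)"
      if "rewrite_step (four_cycles n edge) z w p q" for p q
      using that unfolding rewrite_step_def by (metis add.assoc)
    then have "equivclp (rewrite_step (four_cycles n edge) z w) (t + y) (t + x)"
      using step.hyps(2) by blast
    with step.IH show ?case
      by (rule equivclp_trans)
  qed
  \<comment> \<open>For equivalent a and b the predicates E a and E b are equal, so
    \<open>SOME\<close> returns the same element and \<rho> is constant on classes.\<close>
  define \<rho> where "\<rho> a = (SOME b. E a b)" for a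
  have \<rho>E: "E a (\<rho> a)" for a
    unfolding \<rho>_def using E by (metis someI_ex equivp_reflp)
  have \<rho>: "\<rho> a = \<rho> b \<longleftrightarrow> E a b" for a b
  proof
    assume "E a b"
    then have "E a = E b" using E by (simp add: equivp_def)
    then show "\<rho> a = \<rho> b" by (simp add: \<rho>_def)
  next
    assume "\<rho> a = \<rho> b"
    then show "E a b" using \<rho>E[of a] \<rho>E[of b] E by (metis equivp_symp equivp_transp)
  qed
  have \<rho>add: "\<rho> (t + \<rho> a) = \<rho> (t + a)" for t a
    using \<rho>E[of a] Eadd E \<rho> by metis
  define L where "L = mpoly_extend (\<lambda>u. Poly_Mapping.single (\<rho> u) (1::'k))"
  define J where "J = {f \<in> carrier (mpoly_ring {1..n}). L f = 0}"
  have J: "ideal J (mpoly_ring {1..n})"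
  proof (rule mpoly_idealI)
    fix f g :: "'k mpoly"
    assume f: "f \<in> J" and g: "g \<in> carrier (mpoly_ring {1..n})"
    have "L (g * f) = 0"
      using mpoly_extend_mult_absorb[of \<rho> g f, OF \<rho>add] f by (simp add: J_def L_def)
    then show "g * f \<in> J"
      using f g by (auto simp: J_def intro: mpoly_ring_closed)
  qed (auto simp: J_def L_def mpoly_extend_add intro: mpoly_ring_closed)
  obtain B where B: "B \<subseteq> quadratic_binomials n"
    and gB: "(toric_ideal m n edge :: 'k mpoly set) = Idl\<^bsub>mpoly_ring {1..n}\<^esub> B"
    using gen unfolding generated_by_quadratic_binomials_def by blast
  interpret cring "mpoly_ring {1..n} :: 'k mpoly ring"
    by (rule cring_mpoly_ring)
  have Bc: "B \<subseteq> carrier (mpoly_ring {1..n})"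
    using B unfolding quadratic_binomials_def
    by (fastforce intro: mpoly_ring_closed Var_in_mpoly_ring)
  then have BI: "B \<subseteq> toric_ideal m n edge"
    unfolding gB by (rule genideal_self)
  have "B \<subseteq> J"
  proof
    fix f assume f: "f \<in> B"
    then obtain a b c d where abcd: "{a, b, c, d} \<subseteq> {1..n}"
      and ne: "(Var a * Var b :: 'k mpoly) \<noteq> Var c * Var d" and feq: "f = Var a * Var b - Var c * Var d"
      using B unfolding quadratic_binomials_def by blast
    define s t where "s = Poly_Mapping.single a (1::nat) + Poly_Mapping.single b 1"
      and "t = Poly_Mapping.single c (1::nat) + Poly_Mapping.single d 1"
    have fst: "f = Poly_Mapping.single s 1 - Poly_Mapping.single t 1"
      by (simp add: feq Var_mult s_def t_def)
    have "toric_hom edge f = 0"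
      using f BI by (auto simp: toric_ideal_iff)
    then have "toric_exp edge s = toric_exp edge t"
      by (simp add: fst toric_hom_simps toric_hom_single single_one_inject)
    moreover have "s \<noteq> t"
      using ne by (auto simp: Var_mult s_def t_def)
    ultimately have "consecutive_edges n edge a c b d \<or> consecutive_edges n edge a d b c"
      using quadratic_binomial_consecutive[OF simple abcd] by (simp add: s_def t_def)
    then have "\<exists>C\<in>four_cycles n edge. z C = s \<and> w C = t \<or> z C = t \<and> w C = s"
      using admissible_choice_cases[OF ac, of a c b d] admissible_choice_cases[OF ac, of a d b c]
      unfolding s_def t_def by (metis add.commute)
    then have "rewrite_step (four_cycles n edge) z w s t \<or> rewrite_step (four_cycles n edge) z w t s"
      unfolding rewrite_step_def by (metis add_0)
    then have "E s t"
      unfolding E_def by blast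
    then have "L f = 0"
      using \<rho>[of s t] by (simp add: L_def fst mpoly_extend_diff mpoly_extend_single Const_simps)
    then show "f \<in> J"
      using f Bc by (auto simp: J_def)
  qed
  then have IJ: "toric_ideal m n edge \<subseteq> J"
    unfolding gB using J by (rule genideal_minimal[rotated])
  let ?f = "Poly_Mapping.single u 1 - Poly_Mapping.single v (1::'k)"
  have "?f \<in> toric_ideal m n edge"
    using u v eq by (auto simp: toric_ideal_iff toric_hom_simps toric_hom_single
        intro: mpoly_ring_closed single_in_mpoly_ring)
  then have "L ?f = 0"
    using IJ by (auto simp: J_def)
  then have "Poly_Mapping.single (\<rho> u) (1::'k) = Poly_Mapping.single (\<rho> v) 1"
    by (simp add: L_def mpoly_extend_diff mpoly_extend_single Const_simps)
  then have "\<rho> u = \<rho> v"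
    by (simp add: single_one_inject)
  then show ?thesis
    by (simp add: \<rho> E_def)
qed

lemma finite_four_cycles: "finite (four_cycles n edge)"
proof (rule finite_subset)
  show "four_cycles n edge \<subseteq> Pow {1..n}"
    unfolding four_cycles_def consecutive_edges_def by blast
qed simp

text \<open>B consists of the normal monomials. It meets every fibre of \<open>toric_exp\<close> in
  degree k because rewriting preserves the toric image, and meets it only once because equal images
  are convertible and convertible normal monomials coincide.\<close>

lemma toric_monomial_basis:
  assumes simple: "simple_graph m n edge"
    and gen: "generated_by_quadratic_binomials n (toric_ideal m n edge :: 'k::field mpoly set)"
    and good: "has_good_choice n edge"
    and n: "n \<ge> 1" and k: "k > 2 * card (four_cycles n edge)"
  obtains B where "B \<subseteq> monomials n k" "inj_on (toric_exp edge) B"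
    "toric_exp edge ` B = toric_exp edge ` monomials n k"
    "real (card B) = poly (hilbert_poly n (card (four_cycles n edge))) (real k)"
proof -
  define Z where "Z = four_cycles n edge"
  obtain z w where ac: "admissible_choice n edge z w"
    and cop: "\<And>C D. C \<in> Z \<Longrightarrow> D \<in> Z \<Longrightarrow> C \<noteq> D \<Longrightarrow> coprime_monomials (z C) (z D)"
    and acyc: "\<And>Cs. Cs \<noteq> [] \<Longrightarrow> set Cs \<subseteq> Z \<Longrightarrow> sum_list (map w Cs) \<noteq> sum_list (map z Cs)"
    using good unfolding has_good_choice_def Z_def by metis
  note exps = four_cycle_exponents[OF ac, folded Z_def]
  let ?B = "normal_monomials n Z z k"
  have sub: "?B \<subseteq> monomials n k"
    by (auto simp: normal_monomials_def)
  show ?thesis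
  proof (rule that[OF sub])
    show "inj_on (toric_exp edge) ?B"
    proof (rule inj_onI)
      fix u v assume uv: "u \<in> ?B" "v \<in> ?B" "toric_exp edge u = toric_exp edge v"
      then have "equivclp (rewrite_step Z z w) u v"
        using toric_exp_eq_imp_rewrite[OF simple gen ac] sub unfolding Z_def monomials_def by blast
      then show "u = v"
        using normal_monomial_unique[OF cop uv(1,2)] by blast
    qed
    have step: "toric_exp edge u = toric_exp edge v" if "(rewrite_step Z z w)\<^sup>*\<^sup>* u v" for u v
      using that
      by (induction rule: rtranclp_induct) (auto simp: rewrite_step_def exps)
    show "toric_exp edge ` ?B = toric_exp edge ` monomials n k"
    proof
      show "toric_exp edge ` ?B \<subseteq> toric_exp edge ` monomials n k"
        by (rule image_mono[OF sub])
      show "toric_exp edge ` monomials n k \<subseteq> toric_exp edge ` ?B"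
      proof
        fix x assume "x \<in> toric_exp edge ` monomials n k"
        then obtain u where "u \<in> monomials n k" "x = toric_exp edge u" by blast
        moreover then obtain v where "v \<in> ?B" "(rewrite_step Z z w)\<^sup>*\<^sup>* u v"
          using ex_normal_monomial[of Z w z n u k] acyc exps by metis
        ultimately show "x \<in> toric_exp edge ` ?B"
          using step by blast
      qed
    qed
    have "real (card ?B) = (\<Sum>r = 0..card Z. (-1) ^ r * real (card Z choose r) *
        real (card (monomials n (k - 2 * r))))"
      using k exps cop by (intro card_normal_monomials) (auto simp: Z_def finite_four_cycles)
    then show "real (card ?B) = poly (hilbert_poly n (card (four_cycles n edge))) (real k)"
      using poly_hilbert_poly[OF n, of "card Z" k] k by (simp add: Z_def)
  qed
qed

subsection \<open>The toric ring and its graded pieces\<close>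

lemma subfield_range_Const: "subfield (range Const) (mpoly_ring A :: 'k::field mpoly ring)"
proof -
  interpret cring "mpoly_ring A :: 'k mpoly ring"
    by (rule cring_mpoly_ring)
  have minus: "- Const a = (Const (- a) :: 'k mpoly)" for a
    by (simp add: Const_def single_uminus)
  have "subring (range Const) (mpoly_ring A :: 'k mpoly ring)"
  proof (rule subringI)
    show "\<ominus>\<^bsub>mpoly_ring A\<^esub> h \<in> range Const" if "h \<in> range Const" for h :: "'k mpoly"
      using that minus_mpoly_ring[of h A] minus by auto
  qed (auto simp flip: Const_simps)
  then have "subcring (range Const) (mpoly_ring A :: 'k mpoly ring)"
    by (rule subcringI) (simp add: mult.commute)
  moreover have "Units (mpoly_ring A\<lparr>carrier := range Const\<rparr>) = range Const - {\<zero>\<^bsub>mpoly_ring A\<^esub> :: 'k mpoly}"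
  proof (intro equalityI subsetI)
    fix x :: "'k mpoly" assume "x \<in> Units (mpoly_ring A\<lparr>carrier := range Const\<rparr>)"
    then obtain y where "x \<in> range Const" "y * x = 1"
      by (auto simp: Units_def)
    then show "x \<in> range Const - {\<zero>\<^bsub>mpoly_ring A\<^esub>}" by auto
  next
    fix x :: "'k mpoly" assume x: "x \<in> range Const - {\<zero>\<^bsub>mpoly_ring A\<^esub>}"
    then obtain c where c: "x = Const c"
      by auto
    then have "c \<noteq> 0"
      using x by (auto simp: Const_simps)
    have "Const (1 / c) * x = 1" "x * Const (1 / c) = 1"
      using c \<open>c \<noteq> 0\<close> by (simp_all flip: Const_simps)
    with c show "x \<in> Units (mpoly_ring A\<lparr>carrier := range Const\<rparr>)"
      by (auto simp: Units_def)
  qed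
  ultimately show ?thesis
    by (rule subfieldI)
qed

locale toric_setting =
  fixes m n :: nat and edge :: "nat \<Rightarrow> nat set" and A :: "'k::field mpoly ring" and R :: "'k mpoly set ring"
  assumes A_def: "A = mpoly_ring {1..n}" and R_def: "R = toric_ring m n edge"
    and simple: "simple_graph m n edge"
begin

abbreviation cl :: "'k mpoly \<Rightarrow> 'k mpoly set" where
  "cl \<equiv> toric_class m n edge"

sublocale A: cring A
  unfolding A_def by (rule cring_mpoly_ring)

lemma ideal_I: "ideal (toric_ideal m n edge) A"
  unfolding A_def by (rule ideal_toric_ideal)

lemma R_eq: "R = A Quot toric_ideal m n edge"
  by (simp add: R_def A_def toric_ring_def)

lemma cl_eq: "cl = (+>\<^bsub>A\<^esub>) (toric_ideal m n edge)"
  by (rule ext) (simp add: toric_class_def A_def)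

sublocale R: cring R
  unfolding R_eq by (rule ideal.quotient_is_cring[OF ideal_I A.cring_axioms])

sublocale cl: ring_hom_ring A R cl
  unfolding R_eq cl_eq by (rule ideal.rcos_ring_hom_ring[OF ideal_I])

lemma A_closed:
  assumes "f \<in> carrier A" "g \<in> carrier A"
  shows "f + g \<in> carrier A" "f - g \<in> carrier A" "- f \<in> carrier A" "f * g \<in> carrier A"
  using assms unfolding A_def by (rule mpoly_ring_closed)+

lemma in_A_iff: "f \<in> carrier A \<longleftrightarrow> (\<forall>u\<in>Poly_Mapping.keys f. Poly_Mapping.keys u \<subseteq> {1..n})"
  unfolding A_def by (rule carrier_mpoly_ring)

lemma A_ops [simp]: "x \<otimes>\<^bsub>A\<^esub> y = x * y" "x \<oplus>\<^bsub>A\<^esub> y = x + y" "\<one>\<^bsub>A\<^esub> = 1" "\<zero>\<^bsub>A\<^esub> = 0"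
  by (simp_all add: A_def)

lemma carrier_R: "carrier R = cl ` carrier A"
  unfolding R_eq cl_eq FactRing_def A_RCOSETS_def' by auto

lemma cl_ops:
  assumes "f \<in> carrier A" "g \<in> carrier A"
  shows "cl (f + g) = cl f \<oplus>\<^bsub>R\<^esub> cl g" "cl (f * g) = cl f \<otimes>\<^bsub>R\<^esub> cl g"
  using cl.hom_add[OF assms] cl.hom_mult[OF assms] by simp_all

lemma cl_zero: "cl 0 = \<zero>\<^bsub>R\<^esub>"
  using cl.hom_zero by simp

lemma cl_eq_iff:
  assumes "f \<in> carrier A" "g \<in> carrier A"
  shows "cl f = cl g \<longleftrightarrow> toric_hom edge f = toric_hom edge g"
proof -
  have "cl f = cl g \<longleftrightarrow> f \<ominus>\<^bsub>A\<^esub> g \<in> toric_ideal m n edge"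
    unfolding cl_eq using A.quotient_eq_iff_same_a_r_cos[OF ideal_I assms] by simp
  also have "f \<ominus>\<^bsub>A\<^esub> g = f - g"
    using minus_mpoly_ring[of g "{1..n}"] assms(2) by (simp add: a_minus_def A_def)
  also have "f - g \<in> toric_ideal m n edge \<longleftrightarrow> toric_hom edge f = toric_hom edge g"
    using A_closed(2)[OF assms] by (simp add: toric_ideal_iff A_def toric_hom_simps)
  finally show ?thesis .
qed

lemma ideal_vimage_cl: "ideal J R \<Longrightarrow> ideal {f \<in> carrier A. cl f \<in> J} A"
  by (rule cl.ideal_vimage)

lemma ideal_image_cl: "ideal J A \<Longrightarrow> ideal (cl ` J) R"
  unfolding R_eq cl_eq by (rule A.ring_ideal_imp_quot_ideal[OF ideal_I])

text \<open>The k-th power of the ideal generated by the variables, described through its monomials;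
  its image in R is the k-th power of the ideal of the origin.\<close>

definition order_ge :: "nat \<Rightarrow> 'k mpoly set" where
  "order_ge k = {f \<in> carrier A. \<forall>u\<in>Poly_Mapping.keys f. k \<le> mdeg u}"

lemma order_geD: "f \<in> order_ge k \<Longrightarrow> f \<in> carrier A"
  by (simp add: order_ge_def)

lemma order_ge_mult:
  assumes "f \<in> order_ge k" "g \<in> order_ge l"
  shows "f * g \<in> order_ge (k + l)"
proof -
  have "k + l \<le> mdeg u" if "u \<in> Poly_Mapping.keys (f * g)" for u
    using that keys_mult[of f g] assms by (fastforce simp: order_ge_def intro: add_mono)
  then show ?thesis
    using assms A_closed(4) by (auto simp: order_ge_def)
qed

lemma order_ge_zero: "order_ge 0 = carrier A"
  by (auto simp: order_ge_def)

lemma single_in_order_ge: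
  "Poly_Mapping.keys u \<subseteq> {1..n} \<Longrightarrow> k \<le> mdeg u \<Longrightarrow> Poly_Mapping.single u c \<in> order_ge k"
  by (simp add: order_ge_def in_A_iff)

lemma A_idealI:
  assumes "J \<subseteq> carrier A" "0 \<in> J" "\<And>f g. f \<in> J \<Longrightarrow> g \<in> J \<Longrightarrow> f + g \<in> J"
    "\<And>f g. f \<in> J \<Longrightarrow> g \<in> carrier A \<Longrightarrow> g * f \<in> J"
  shows "ideal J A"
  using assms unfolding A_def by (rule mpoly_idealI)

lemma ideal_order_ge: "ideal (order_ge k) A"
proof (rule A_idealI)
  fix f g assume f: "f \<in> order_ge k" and g: "g \<in> order_ge k"
  then have "f + g \<in> carrier A"
    using A_closed(1) by (auto simp: order_ge_def)
  then show "f + g \<in> order_ge k"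
    using f g keys_add[of f g] by (auto simp: order_ge_def)
next
  fix f g :: "'k mpoly"
  assume "f \<in> order_ge k" "g \<in> carrier A"
  then show "g * f \<in> order_ge k"
    using order_ge_mult[of g 0 f k] by (simp add: order_ge_zero)
qed (auto simp: order_ge_def in_A_iff)

lemma order_ge_subset:
  assumes J: "ideal J A"
    and mon: "\<And>u c. Poly_Mapping.keys u \<subseteq> {1..n} \<Longrightarrow> k \<le> mdeg u \<Longrightarrow> Poly_Mapping.single u c \<in> J"
  shows "order_ge k \<subseteq> J"
proof
  fix f assume f: "f \<in> order_ge k"
  have "(\<Sum>u\<in>S. Poly_Mapping.single u (Poly_Mapping.lookup f u)) \<in> J" if "S \<subseteq> Poly_Mapping.keys f" for S
    using finite_subset[OF that finite_keys] that
  proof (induction S rule: finite_induct)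
    case empty
    then show ?case using mpoly_ideal_closed(1)[OF J[unfolded A_def]] by simp
  next
    case (insert u S)
    then have "Poly_Mapping.single u (Poly_Mapping.lookup f u) \<in> J"
      using f by (intro mon) (auto simp: order_ge_def in_A_iff)
    then show ?case
      using insert mpoly_ideal_closed(2)[OF J[unfolded A_def]] by simp
  qed
  from this[of "Poly_Mapping.keys f"] show "f \<in> J"
    using mpoly_eq_sum_single[of f] by simp
qed

lemma monomial_split:
  assumes "Poly_Mapping.keys u \<subseteq> {1..n}" "Suc k \<le> mdeg u"
  obtains i v where "i \<in> {1..n}" "Poly_Mapping.keys v \<subseteq> {1..n}" "k \<le> mdeg v"
    "u = v + Poly_Mapping.single i 1"
proof -
  have "u \<noteq> 0" using assms by auto
  then obtain i where i: "i \<in> Poly_Mapping.keys u"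
    by (metis keys_eq_empty ex_in_conv)
  define v where "v = u - Poly_Mapping.single i 1"
  have "u = v + Poly_Mapping.single i 1"
    using i unfolding v_def
    by (intro poly_mapping_eqI) (auto simp: lookup_add lookup_minus lookup_single when_def in_keys_iff)
  then show ?thesis
    using that[of i v] i assms by auto
qed

lemma single_split: "Poly_Mapping.single (v + Poly_Mapping.single i 1) c = Poly_Mapping.single v c * (Var i :: 'k mpoly)"
  by (simp add: Var_def mult_single)

lemma Var_in_order_ge: "i \<in> {1..n} \<Longrightarrow> Var i \<in> order_ge 1"
  unfolding Var_def by (rule single_in_order_ge) auto

lemma toric_origin_eq: "toric_origin m n edge = cl ` order_ge 1"
proof
  have gens: "cl ` Var ` {1..n} \<subseteq> carrier R"
    using Var_in_mpoly_ring[of _ "{1..n}"] unfolding carrier_R A_def by blast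
  have origin: "toric_origin m n edge = Idl\<^bsub>R\<^esub> (cl ` Var ` {1..n})"
    by (simp add: toric_origin_def R_def)
  show "toric_origin m n edge \<subseteq> cl ` order_ge 1"
    unfolding origin using Var_in_order_ge
    by (intro R.genideal_minimal ideal_image_cl ideal_order_ge) blast
  have idl: "ideal (toric_origin m n edge) R"
    unfolding origin by (rule R.genideal_ideal[OF gens])
  have "order_ge 1 \<subseteq> {f \<in> carrier A. cl f \<in> toric_origin m n edge}"
  proof (rule order_ge_subset[OF ideal_vimage_cl[OF idl]])
    fix u and c :: 'k assume u: "Poly_Mapping.keys u \<subseteq> {1..n}" "1 \<le> mdeg u"
    then obtain i v where i: "i \<in> {1..n}" and v: "Poly_Mapping.keys v \<subseteq> {1..n}"
      and uv: "u = v + Poly_Mapping.single i 1"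
      using monomial_split[of u 0] by auto
    have vA: "Poly_Mapping.single v c \<in> carrier A" and iA: "Var i \<in> carrier A"
      using i v by (auto simp: in_A_iff Var_def)
    have "cl (Var i) \<in> toric_origin m n edge"
      unfolding origin using R.genideal_self[OF gens] i by blast
    then have "cl (Poly_Mapping.single u c) \<in> toric_origin m n edge"
      unfolding uv single_split cl_ops(2)[OF vA iA]
      using ideal.I_l_closed[OF idl _ cl.hom_closed[OF vA]] by simp
    then show "Poly_Mapping.single u c \<in> {f \<in> carrier A. cl f \<in> toric_origin m n edge}"
      using u by (simp add: in_A_iff)
  qed
  then show "cl ` order_ge 1 \<subseteq> toric_origin m n edge" by blast
qed

text \<open>Monomial by monomial: a term of degree at least k + 1 splits off a variable and leaves
  degree at least k, so its class is one of the products generating the ideal product.\<close>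

lemma ideal_power_origin: "ideal_power R (toric_origin m n edge) k = cl ` order_ge k"
proof (induction k)
  case 0
  show ?case
    by (simp add: ideal_power_def nat_pow_def ideals_set_def order_ge_zero carrier_R)
next
  case (Suc k)
  let ?P = "ideal_prod R (cl ` order_ge k) (cl ` order_ge 1)"
  have "ideal_power R (toric_origin m n edge) (Suc k) = ?P"
    using Suc by (simp add: ideal_power_def nat_pow_def ideals_set_def toric_origin_eq)
  moreover have "?P = cl ` order_ge (Suc k)"
  proof
    show "?P \<subseteq> cl ` order_ge (Suc k)"
    proof
      fix s assume "s \<in> ?P"
      then show "s \<in> cl ` order_ge (Suc k)"
      proof (induction s rule: ideal_prod.induct)
        case (prod i j)
        then obtain f g where "f \<in> order_ge k" "i = cl f" "g \<in> order_ge 1" "j = cl g" by blast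
        then show ?case
          using order_ge_mult[of f k g 1] cl_ops(2)[of f g] order_geD by auto
      next
        case (sum s t)
        from sum.IH show ?case
          by (rule additive_subgroup.a_closed[OF ideal.axioms(1)[OF ideal_image_cl[OF ideal_order_ge]]])
      qed
    qed
    have idl: "ideal ?P R"
      by (intro R.ideal_prod_is_ideal ideal_image_cl ideal_order_ge)
    have "order_ge (Suc k) \<subseteq> {f \<in> carrier A. cl f \<in> ?P}"
    proof (rule order_ge_subset[OF ideal_vimage_cl[OF idl]])
      fix u and c :: 'k assume u: "Poly_Mapping.keys u \<subseteq> {1..n}" "Suc k \<le> mdeg u"
      then obtain i v where i: "i \<in> {1..n}" and v: "Poly_Mapping.keys v \<subseteq> {1..n}" "k \<le> mdeg v"
        and uv: "u = v + Poly_Mapping.single i 1"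
        using monomial_split[of u k] by auto
      have vk: "Poly_Mapping.single v c \<in> order_ge k"
        using v by (rule single_in_order_ge)
      have "cl (Poly_Mapping.single u c) \<in> ?P"
        unfolding uv single_split cl_ops(2)[OF order_geD[OF vk] order_geD[OF Var_in_order_ge[OF i]]]
        using vk Var_in_order_ge[OF i] by (intro ideal_prod.prod imageI)
      then show "Poly_Mapping.single u c \<in> {f \<in> carrier A. cl f \<in> ?P}"
        using u by (simp add: in_A_iff)
    qed
    then show "cl ` order_ge (Suc k) \<subseteq> ?P" by blast
  qed
  ultimately show ?case by simp
qed

lemma mdeg_toric: "Poly_Mapping.keys u \<subseteq> {1..n} \<Longrightarrow> mdeg (toric_exp edge u) = 2 * mdeg u"
  using simple by (intro mdeg_toric_exp) (auto simp: simple_graph_def)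

text \<open>Toric exponents of degree at most 2k cannot be reached from monomials of degree above k,
  so the coefficients of the toric image at these exponents are well defined on R modulo the
  (k+1)-st power of the origin. They separate the monomials in B, while every monomial of degree k
  has the same class in R as some member of B.\<close>

lemma gr_dim_eq_card:
  assumes B: "B \<subseteq> monomials n k" and inj: "inj_on (toric_exp edge) B"
    and im: "toric_exp edge ` B = toric_exp edge ` monomials n k"
  shows "gr_dim R (toric_scalars m n edge) (toric_origin m n edge) k = card B"
proof -
  define J where "J = cl ` order_ge (k + 1)"
  define Q where "Q = R Quot J"
  define \<psi> where "\<psi> f = J +>\<^bsub>R\<^esub> cl f" for f
  have J: "ideal J R"
    unfolding J_def by (intro ideal_image_cl ideal_order_ge)
  interpret Q: cring Q
    unfolding Q_def by (rule ideal.quotient_is_cring[OF J R.cring_axioms])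
  interpret J: ring_hom_ring R Q "(+>\<^bsub>R\<^esub>) J"
    unfolding Q_def by (rule ideal.rcos_ring_hom_ring[OF J])
  interpret \<psi>: ring_hom_ring A Q \<psi>
  proof (rule ring_hom_ringI2)
    have "(+>\<^bsub>R\<^esub>) J \<circ> cl \<in> ring_hom A Q"
      using cl.homh J.homh by (rule ring_hom_trans)
    then show "\<psi> \<in> ring_hom A Q"
      by (simp add: \<psi>_def[abs_def] comp_def)
  qed unfold_locales
  have \<psi>_add: "\<psi> (f + g) = \<psi> f \<oplus>\<^bsub>Q\<^esub> \<psi> g" if "f \<in> carrier A" "g \<in> carrier A" for f g
    using \<psi>.hom_add[OF that] by simp
  have \<psi>_mult: "\<psi> (f * g) = \<psi> f \<otimes>\<^bsub>Q\<^esub> \<psi> g" if "f \<in> carrier A" "g \<in> carrier A" for f g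
    using \<psi>.hom_mult[OF that] by simp
  have \<psi>_eq: "\<psi> f = \<psi> g" if "f \<in> carrier A" "g \<in> carrier A" "toric_hom edge f = toric_hom edge g" for f g
    using that cl_eq_iff[of f g] by (simp add: \<psi>_def)
  have \<psi>_zero: "\<psi> f = \<zero>\<^bsub>Q\<^esub>" if "f \<in> order_ge (k + 1)" for f
    using that R.a_rcos_zero[OF J, of "cl f"] by (auto simp: \<psi>_def Q_def FactRing_def J_def)
  have \<psi>_lookup: "Poly_Mapping.lookup (toric_hom edge f) \<alpha> = Poly_Mapping.lookup (toric_hom edge g) \<alpha>"
    if f: "f \<in> carrier A" and g: "g \<in> carrier A" and eq: "\<psi> f = \<psi> g" and \<alpha>: "mdeg \<alpha> \<le> 2 * k" for f g \<alpha>
  proof -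
    have "cl f \<ominus>\<^bsub>R\<^esub> cl g \<in> J"
      using eq R.quotient_eq_iff_same_a_r_cos[OF J] f g by (simp add: \<psi>_def)
    then obtain h where h: "h \<in> order_ge (k + 1)" "cl f \<ominus>\<^bsub>R\<^esub> cl g = cl h"
      unfolding J_def by blast
    then have "cl f = cl (h + g)"
      using f g order_geD[OF h(1)] cl_ops(1)[of h g]
      by (metis a_minus_def R.add.inv_solve_right cl.hom_closed R.minus_closed)
    then have "toric_hom edge f = toric_hom edge h + toric_hom edge g"
      using f g order_geD[OF h(1)] by (simp add: cl_eq_iff A_closed toric_hom_add)
    moreover have "Poly_Mapping.lookup (toric_hom edge h) \<alpha> = 0"
    proof -
      have "toric_exp edge u \<noteq> \<alpha>" if "u \<in> Poly_Mapping.keys h" for u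
      proof -
        have "Poly_Mapping.keys u \<subseteq> {1..n}" "k + 1 \<le> mdeg u"
          using that h(1) by (auto simp: order_ge_def in_A_iff)
        then show ?thesis
          using mdeg_toric[of u] \<alpha> by auto
      qed
      then show ?thesis
        unfolding lookup_toric_hom by (intro sum.neutral) blast
    qed
    ultimately show ?thesis
      by (simp add: lookup_add)
  qed
  define K where "K = \<psi> ` range Const"
  \<comment> \<open>The coefficient at the exponent 0 shows that the quotient is not the zero ring,
    so that the image of K in it is a field.\<close>
  have "\<psi> 1 \<noteq> \<psi> 0"
    using \<psi>_lookup[of 1 0 0] by (auto simp: A_def toric_hom_simps)
  then have "subfield K Q"
    unfolding K_def
    using \<psi>.img_is_subfield(2)[of "range Const"] subfield_range_Const[of "{1..n}"]
      \<psi>.hom_one \<psi>.hom_zero by (simp add: A_def)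
  define span :: "monomial set \<Rightarrow> 'k mpoly set"
    where "span S = range (\<lambda>c. \<Sum>u\<in>S. Poly_Mapping.single u (c u))" for S
  have monA: "Poly_Mapping.single u c \<in> carrier A" if "u \<in> monomials n k" for u c
    using that by (simp add: in_A_iff monomials_def)
  have sumA: "(\<Sum>u\<in>S. Poly_Mapping.single u (c u)) \<in> carrier A" if "S \<subseteq> monomials n k" for S c
    using that monA unfolding A_def by (intro sum_in_mpoly_ring) auto
  have finB: "finite B"
    using B finite_monomials by (rule finite_subset)
  \<comment> \<open>One monomial u is added at a time: the coefficient at
    \<open>toric_exp edge u\<close> distinguishes it from all combinations of the earlier ones, as
    \<open>toric_exp edge\<close> is injective on B.\<close>
  have dimension: "ring.dimension Q (card S) K (\<psi> ` span S)" if "S \<subseteq> B" for S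
    using finite_subset[OF that finB] that
  proof (induction S rule: finite_induct)
    case empty
    have "\<psi> ` span {} = {\<zero>\<^bsub>Q\<^esub>}"
      using \<psi>.hom_zero by (simp add: span_def)
    then show ?case by simp
  next
    case (insert u S)
    have Sk: "insert u S \<subseteq> monomials n k"
      using insert.prems B by blast
    define v where "v = \<psi> (Poly_Mapping.single u 1)"
    have vQ: "v \<in> carrier Q"
      unfolding v_def using Sk monA by auto
    have "v \<notin> \<psi> ` span S"
    proof
      assume "v \<in> \<psi> ` span S"
      then obtain c where "\<psi> (Poly_Mapping.single u 1) = \<psi> (\<Sum>w\<in>S. Poly_Mapping.single w (c w))"
        unfolding v_def span_def by blast
      then have "Poly_Mapping.lookup (toric_hom edge (Poly_Mapping.single u (1::'k))) (toric_exp edge u) =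
          Poly_Mapping.lookup (toric_hom edge (\<Sum>w\<in>S. Poly_Mapping.single w (c w))) (toric_exp edge u)"
        using Sk monA sumA mdeg_toric[of u] by (intro \<psi>_lookup) (auto simp: monomials_def)
      moreover have "toric_exp edge w \<noteq> toric_exp edge u" if "w \<in> S" for w
        using inj insert that unfolding inj_on_def by blast
      ultimately show False
        by (simp add: toric_hom_eq mpoly_extend_sum mpoly_extend_single lookup_sum lookup_single when_def)
    qed
    moreover have "ring.line_extension Q K v (\<psi> ` span S) = \<psi> ` span (insert u S)"
    proof -
      have "ring.line_extension Q K v (\<psi> ` span S) =
          {\<psi> (Const a) \<otimes>\<^bsub>Q\<^esub> v \<oplus>\<^bsub>Q\<^esub> \<psi> (\<Sum>w\<in>S. Poly_Mapping.single w (c w)) | a c. True}"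
        unfolding Q.line_extension_def set_add_def' r_coset_def K_def span_def by auto
      also have "\<dots> = {\<psi> (\<Sum>w\<in>insert u S. Poly_Mapping.single w ((c(u := a)) w)) | a c. True}"
      proof -
        have "\<psi> (Const a) \<otimes>\<^bsub>Q\<^esub> v \<oplus>\<^bsub>Q\<^esub> \<psi> (\<Sum>w\<in>S. Poly_Mapping.single w (c w)) =
            \<psi> (\<Sum>w\<in>insert u S. Poly_Mapping.single w ((c(u := a)) w))" for a c
        proof -
          have "(\<Sum>w\<in>insert u S. Poly_Mapping.single w ((c(u := a)) w)) =
              Const a * Poly_Mapping.single u 1 + (\<Sum>w\<in>S. Poly_Mapping.single w (c w))"
            using insert.hyps by (auto intro!: sum.cong)
          moreover have "Const a \<in> carrier A" "Poly_Mapping.single u 1 \<in> carrier A"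
            "(\<Sum>w\<in>S. Poly_Mapping.single w (c w)) \<in> carrier A"
            using Sk monA sumA by (auto simp: A_def)
          ultimately show ?thesis
            by (simp add: v_def \<psi>_add \<psi>_mult A_closed del: Const_times_single)
        qed
        then show ?thesis by simp
      qed
      also have "\<dots> = \<psi> ` span (insert u S)"
      proof (intro equalityI subsetI)
        fix x assume "x \<in> \<psi> ` span (insert u S)"
        then obtain c where "x = \<psi> (\<Sum>w\<in>insert u S. Poly_Mapping.single w (c w))"
          unfolding span_def by blast
        then have "x = \<psi> (\<Sum>w\<in>insert u S. Poly_Mapping.single w ((c(u := c u)) w))"
          by (simp only: fun_upd_triv)
        then show "x \<in> {\<psi> (\<Sum>w\<in>insert u S. Poly_Mapping.single w ((c(u := a)) w)) | a c. True}"
          by blast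
      qed (unfold span_def, blast)
      finally show ?thesis .
    qed
    ultimately show ?case
      using Q.Suc_dim[OF vQ, of "\<psi> ` span S" "card S" K] insert by simp
  qed
  have span_add: "\<psi> f \<oplus>\<^bsub>Q\<^esub> \<psi> g \<in> \<psi> ` span B" if f: "f \<in> span B" and g: "g \<in> span B" for f g
  proof -
    obtain c where c: "f = (\<Sum>u\<in>B. Poly_Mapping.single u (c u))"
      using f unfolding span_def by (elim rangeE)
    obtain d where d: "g = (\<Sum>u\<in>B. Poly_Mapping.single u (d u))"
      using g unfolding span_def by (elim rangeE)
    have "f + g = (\<Sum>u\<in>B. Poly_Mapping.single u (c u + d u))"
      unfolding c d by (simp add: single_add sum.distrib)
    then have "f + g \<in> span B" unfolding span_def by (intro range_eqI[of _ _ "\<lambda>u. c u + d u"])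
    moreover have "f \<in> carrier A" "g \<in> carrier A"
      unfolding c d using sumA[OF B] by auto
    ultimately show ?thesis using \<psi>_add by (metis image_eqI)
  qed
  have zero_span: "0 \<in> span B"
    unfolding span_def by (rule range_eqI[of _ _ "\<lambda>_. 0"]) simp
  \<comment> \<open>Spanning: a monomial of degree k is replaced by the member of B with the same
    toric image, and one of higher degree is sent to zero.\<close>
  have "\<psi> ` order_ge k = \<psi> ` span B"
  proof (intro equalityI image_subsetI)
    fix f assume "f \<in> span B"
    then obtain c where "f = (\<Sum>u\<in>B. Poly_Mapping.single u (c u))"
      unfolding span_def by (elim rangeE)
    moreover have "(\<Sum>u\<in>B. Poly_Mapping.single u (c u)) \<in> order_ge k"
    proof -
      have "Poly_Mapping.keys (\<Sum>u\<in>B. Poly_Mapping.single u (c u)) \<subseteq> B"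
        using finB by (auto simp: in_keys_iff lookup_sum lookup_single when_def split: if_splits)
      then show ?thesis
        using sumA[OF B] B by (auto simp: order_ge_def monomials_def)
    qed
    ultimately show "\<psi> f \<in> \<psi> ` order_ge k" by blast
  next
    fix f assume f: "f \<in> order_ge k"
    have "\<psi> (\<Sum>u\<in>S. Poly_Mapping.single u (Poly_Mapping.lookup f u)) \<in> \<psi> ` span B" if "S \<subseteq> Poly_Mapping.keys f" for S
      using finite_subset[OF that finite_keys] that
    proof (induction S rule: finite_induct)
      case empty
      show ?case using zero_span by auto
    next
      case (insert u S)
      let ?s = "Poly_Mapping.single u (Poly_Mapping.lookup f u)"
      have u: "Poly_Mapping.keys u \<subseteq> {1..n}" "k \<le> mdeg u"
        using insert.prems f by (auto simp: order_ge_def in_A_iff)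
      then have sA: "?s \<in> carrier A"
        by (simp add: in_A_iff)
      have "\<psi> ?s \<in> \<psi> ` span B"
      proof (cases "mdeg u = k")
        case True
        then obtain b where b: "b \<in> B" "toric_exp edge b = toric_exp edge u"
          using im u unfolding monomials_def by (metis (mono_tags, lifting) imageE image_eqI mem_Collect_eq)
        have "\<psi> ?s = \<psi> (Poly_Mapping.single b (Poly_Mapping.lookup f u))"
          using sA monA[of b] b B by (intro \<psi>_eq) (auto simp: toric_hom_single)
        moreover have "Poly_Mapping.single b (Poly_Mapping.lookup f u) \<in> span B"
          unfolding span_def using b finB
          by (intro range_eqI[of _ _ "\<lambda>w. if w = b then Poly_Mapping.lookup f u else 0"])
            (simp add: if_distrib[of "Poly_Mapping.single _"] cong: if_cong)
        ultimately show ?thesis by blast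
      next
        case False
        then have "\<psi> ?s = \<zero>\<^bsub>Q\<^esub>"
          using u by (intro \<psi>_zero single_in_order_ge) auto
        also have "\<dots> = \<psi> 0"
          using \<psi>.hom_zero by simp
        finally show ?thesis
          using zero_span by blast
      qed
      moreover have "(\<Sum>u\<in>S. Poly_Mapping.single u (Poly_Mapping.lookup f u)) \<in> carrier A"
        unfolding A_def using insert.prems f
        by (intro sum_in_mpoly_ring single_in_mpoly_ring) (auto simp: order_ge_def in_A_iff)
      ultimately show ?case
        using insert span_add sA by (auto simp: \<psi>_add)
    qed
    from this[of "Poly_Mapping.keys f"] show "\<psi> f \<in> \<psi> ` span B"
      using mpoly_eq_sum_single[of f] by simp
  qed
  moreover have "gr_dim R (toric_scalars m n edge) (toric_origin m n edge) k =
      ring.dim Q K (\<psi> ` order_ge k)"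
    by (simp add: gr_dim_def Let_def ideal_power_origin toric_scalars_def image_image K_def \<psi>_def Q_def J_def)
  ultimately show ?thesis
    using Q.dimI[OF \<open>subfield K Q\<close> dimension[OF subset_refl]] by (simp add: over_def)
qed

end

subsection \<open>Krull dimension: upper bound\<close>

text \<open>Gaussian elimination, one equation x at a time: an unknown b with v b x nonzero is
  eliminated from the remaining equations, and its value is recovered from equation x.\<close>

lemma underdetermined_system:
  fixes v :: "'a \<Rightarrow> 'b \<Rightarrow> 'k::field"
  assumes "finite X" "finite S" "card X < card S"
  shows "\<exists>c. (\<exists>a\<in>S. c a \<noteq> 0) \<and> (\<forall>x\<in>X. (\<Sum>a\<in>S. c a * v a x) = 0)"
  using assms
proof (induction X arbitrary: S v rule: finite_induct)
  case empty
  then obtain a where "a \<in> S" by fastforce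
  then show ?case by (intro exI[of _ "\<lambda>_. 1"]) auto
next
  case (insert x X)
  show ?case
  proof (cases "\<forall>a\<in>S. v a x = 0")
    case True
    moreover obtain c where "\<exists>a\<in>S. c a \<noteq> 0" "\<forall>x\<in>X. (\<Sum>a\<in>S. c a * v a x) = 0"
      using insert.IH[of S v] insert.prems insert.hyps by auto
    ultimately show ?thesis by (intro exI[of _ c]) auto
  next
    case False
    then obtain b where b: "b \<in> S" "v b x \<noteq> 0" by blast
    define v' where "v' a y = v a y - v a x / v b x * v b y" for a y
    have "card X < card (S - {b})"
      using insert.prems insert.hyps b by (simp add: less_diff_conv)
    then obtain c where c: "\<exists>a\<in>S - {b}. c a \<noteq> 0" "\<forall>y\<in>X. (\<Sum>a\<in>S - {b}. c a * v' a y) = 0"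
      using insert.IH[of "S - {b}" v'] insert.prems by auto
    define c' where "c' = c(b := - (\<Sum>a\<in>S - {b}. c a * v a x) / v b x)"
    have eq: "(\<Sum>a\<in>S. c' a * v a y) = (\<Sum>a\<in>S - {b}. c a * v' a y)" for y
    proof -
      have "(\<Sum>a\<in>S. c' a * v a y) = c' b * v b y + (\<Sum>a\<in>S - {b}. c' a * v a y)"
        using b insert.prems by (simp add: sum.remove)
      also have "(\<Sum>a\<in>S - {b}. c' a * v a y) = (\<Sum>a\<in>S - {b}. c a * v a y)"
        by (intro sum.cong) (auto simp: c'_def)
      also have "c' b * v b y = - (\<Sum>a\<in>S - {b}. c a * (v a x / v b x * v b y))"
        by (simp add: c'_def sum_divide_distrib sum_distrib_right sum_distrib_left algebra_simps)
      finally show ?thesis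
        by (simp add: v'_def right_diff_distrib sum_subtractf)
    qed
    have "\<forall>y\<in>insert x X. (\<Sum>a\<in>S. c' a * v a y) = 0"
      using c(2) b by (simp add: eq) (simp add: v'_def)
    moreover have "\<exists>a\<in>S. c' a \<noteq> 0"
      using c(1) by (auto simp: c'_def)
    ultimately show ?thesis by blast
  qed
qed

lemma prime_mpolyD:
  fixes Q :: "'k::field mpoly set"
  assumes "primeideal Q (mpoly_ring V)"
  shows "ideal Q (mpoly_ring V)"
    "f \<in> carrier (mpoly_ring V) \<Longrightarrow> g \<in> carrier (mpoly_ring V) \<Longrightarrow> f * g \<in> Q \<Longrightarrow> f \<in> Q \<or> g \<in> Q"
    "c \<noteq> 0 \<Longrightarrow> Const c \<notin> Q"
    "f \<in> carrier (mpoly_ring V) \<Longrightarrow> f ^ k \<in> Q \<Longrightarrow> f \<in> Q"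
proof -
  interpret primeideal Q "mpoly_ring V" by fact
  show idl: "ideal Q (mpoly_ring V)" by (rule is_ideal)
  show prime: "f * g \<in> Q \<Longrightarrow> f \<in> Q \<or> g \<in> Q"
    if "f \<in> carrier (mpoly_ring V)" "g \<in> carrier (mpoly_ring V)" for f g
    using I_prime[OF that] by simp
  have one: "1 \<notin> Q"
    using one_imp_carrier I_notcarr by auto
  show const: "Const c \<notin> Q" if "c \<noteq> 0" for c
  proof
    assume "Const c \<in> Q"
    then have "Const (1 / c) * Const c \<in> Q"
      using mpoly_ideal_closed(5)[OF idl] by simp
    then show False
      using that one by (simp flip: Const_simps)
  qed
  show "f \<in> Q" if "f \<in> carrier (mpoly_ring V)" "f ^ k \<in> Q" for f k
    using that(2)
  proof (induction k)
    case 0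
    then show ?case using one by simp
  next
    case (Suc k)
    then show ?case
      using prime[of f "f ^ k"] that(1) power_in_mpoly_ring[OF that(1), of k] by auto
  qed
qed

abbreviation list_monom :: "'k::field mpoly list \<Rightarrow> nat list \<Rightarrow> 'k mpoly" where
  "list_monom fs a \<equiv> prod_list (map2 (^) fs a)"

lemma list_monom_closed:
  "set fs \<subseteq> carrier (mpoly_ring V) \<Longrightarrow> list_monom fs a \<in> carrier (mpoly_ring V)"
  by (rule prod_list_in_mpoly_ring) (auto dest!: set_zip_leftD intro: power_in_mpoly_ring)

text \<open>The trailing monomial, in the lexicographic order, of a relation can be stripped off one
  variable at a time, moving one step up in the chain of primes each time.\<close>

lemma prime_chain_no_relation:
  fixes Q :: "nat \<Rightarrow> 'k::field mpoly set"
  assumes "\<And>i. i \<le> length fs \<Longrightarrow> primeideal (Q i) (mpoly_ring V)"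
    and "\<And>i. i < length fs \<Longrightarrow> Q i \<subseteq> Q (Suc i)"
    and "\<And>i. i < length fs \<Longrightarrow> fs ! i \<in> Q (Suc i) - Q i"
    and "finite E" "E \<noteq> {}" "\<And>a. a \<in> E \<Longrightarrow> length a = length fs \<and> c a \<noteq> 0"
    and "(\<Sum>a\<in>E. Const (c a) * list_monom fs a) \<in> Q 0"
  shows False
  using assms
proof (induction fs arbitrary: Q E c)
  case Nil
  then have "E = {[]}" by auto
  with Nil.prems show False
    using prime_mpolyD(3)[OF Nil.prems(1)[of 0], of "c []"] by simp
next
  case (Cons f fs)
  have p0: "primeideal (Q 0) (mpoly_ring V)" and p1: "primeideal (Q 1) (mpoly_ring V)"
    using Cons.prems(1) by simp_all
  have f: "f \<in> Q 1" "f \<notin> Q 0" and Q01: "Q 0 \<subseteq> Q 1"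
    using Cons.prems(3)[of 0] Cons.prems(2)[of 0] by auto
  have fA: "f \<in> carrier (mpoly_ring V)"
    using f mpoly_ideal_closed(6)[OF prime_mpolyD(1)[OF p1]] by blast
  have fsA: "set fs \<subseteq> carrier (mpoly_ring V)"
  proof
    fix g assume "g \<in> set fs"
    then obtain i where i: "i < length fs" "g = fs ! i" by (metis in_set_conv_nth)
    then have "g \<in> Q (Suc (Suc i))"
      using Cons.prems(3)[of "Suc i"] by simp
    then show "g \<in> carrier (mpoly_ring V)"
      using mpoly_ideal_closed(6)[OF prime_mpolyD(1)[OF Cons.prems(1)[of "Suc (Suc i)"]]] i by auto
  qed
  \<comment> \<open>The least exponent of f in the relation. The factor f^h can be cancelled modulo
    the prime Q 0, since f lies outside it.\<close>
  define h where "h = Min (hd ` E)"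
  have h: "h \<in> hd ` E" "\<And>a. a \<in> E \<Longrightarrow> h \<le> hd a"
    unfolding h_def using Cons.prems(4,5) by auto
  have split: "a = hd a # tl a" if "a \<in> E" for a
    using Cons.prems(6)[OF that] by (cases a) auto
  define t where "t a = Const (c a) * (f ^ (hd a - h) * list_monom fs (tl a))" for a
  have tA: "t a \<in> carrier (mpoly_ring V)" for a
    unfolding t_def using fA fsA by (intro mpoly_ring_closed power_in_mpoly_ring list_monom_closed) auto
  have "(\<Sum>a\<in>E. Const (c a) * list_monom (f # fs) a) = (\<Sum>a\<in>E. f ^ h * t a)"
  proof (rule sum.cong[OF refl])
    fix a assume a: "a \<in> E"
    have "list_monom (f # fs) a = f ^ hd a * list_monom fs (tl a)"
      by (subst split[OF a]) simp
    also have "f ^ hd a = f ^ h * f ^ (hd a - h)"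
      using h(2)[OF a] by (simp flip: power_add)
    finally show "Const (c a) * list_monom (f # fs) a = f ^ h * t a"
      by (simp add: t_def ac_simps)
  qed
  also have "\<dots> = f ^ h * (\<Sum>a\<in>E. t a)"
    by (simp add: sum_distrib_left)
  finally have "f ^ h * (\<Sum>a\<in>E. t a) \<in> Q 0"
    using Cons.prems(7) by simp
  then have "f ^ h \<in> Q 0 \<or> (\<Sum>a\<in>E. t a) \<in> Q 0"
    using fA tA by (intro prime_mpolyD(2)[OF p0] power_in_mpoly_ring sum_in_mpoly_ring)
  then have "(\<Sum>a\<in>E. t a) \<in> Q 1"
    using prime_mpolyD(4)[OF p0 fA] f Q01 by blast
  \<comment> \<open>Modulo Q 1, which contains f, only the terms with exponent exactly h survive.
    After the cancellation they are free of f and form a relation among the remaining elements, for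
    the chain that starts at Q 1.\<close>
  define E0 where "E0 = {a \<in> E. hd a = h}"
  have sum_Q1: "(\<Sum>a\<in>S. t a) \<in> Q 1" if "S \<subseteq> E - E0" for S
    using finite_subset[OF that] that Cons.prems(4)
  proof (induction S rule: infinite_finite_induct)
    case (insert a S)
    then have "a \<in> E" "hd a \<noteq> h" by (auto simp: E0_def)
    then obtain k where k: "hd a - h = Suc k"
      using h(2)[of a] by (metis Suc_diff_Suc le_neq_implies_less)
    have "t a = (Const (c a) * (f ^ k * list_monom fs (tl a))) * f"
      by (simp add: t_def k ac_simps)
    also have "\<dots> \<in> Q 1"
      using fA fsA f
      by (intro mpoly_ideal_closed(5)[OF prime_mpolyD(1)[OF p1]] mpoly_ring_closed
          power_in_mpoly_ring list_monom_closed) auto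
    finally show ?case
      using insert mpoly_ideal_closed(2)[OF prime_mpolyD(1)[OF p1]] by simp
  qed (use mpoly_ideal_closed(1)[OF prime_mpolyD(1)[OF p1]] in auto)
  have "(\<Sum>a\<in>E. t a) - (\<Sum>a\<in>E - E0. t a) \<in> Q 1"
    using \<open>(\<Sum>a\<in>E. t a) \<in> Q 1\<close> sum_Q1[of "E - E0"]
    by (intro mpoly_ideal_closed(4)[OF prime_mpolyD(1)[OF p1]]) auto
  also have "(\<Sum>a\<in>E. t a) - (\<Sum>a\<in>E - E0. t a) = (\<Sum>a\<in>E0. t a)"
    using Cons.prems(4) by (simp add: E0_def sum_diff)
  also have "\<dots> = (\<Sum>b\<in>tl ` E0. Const (c (h # b)) * list_monom fs b)"
  proof (subst sum.reindex)
    show "inj_on tl E0"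
    proof (rule inj_onI)
      fix a b assume "a \<in> E0" "b \<in> E0" "tl a = tl b"
      then show "a = b"
        using split[of a] split[of b] by (auto simp: E0_def)
    qed
    show "(\<Sum>a\<in>E0. t a) = sum ((\<lambda>b. Const (c (h # b)) * list_monom fs b) \<circ> tl) E0"
    proof (rule sum.cong[OF refl])
      fix a assume a: "a \<in> E0"
      then have "h # tl a = a"
        using split[of a] by (simp add: E0_def)
      with a show "t a = ((\<lambda>b. Const (c (h # b)) * list_monom fs b) \<circ> tl) a"
        by (simp add: t_def E0_def)
    qed
  qed
  finally have rel: "(\<Sum>b\<in>tl ` E0. Const (c (h # b)) * list_monom fs b) \<in> Q 1" .
  show False
  proof (rule Cons.IH[of "\<lambda>i. Q (Suc i)" "tl ` E0" "\<lambda>b. c (h # b)"])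
    show "finite (tl ` E0)" "tl ` E0 \<noteq> {}"
      using Cons.prems(4) h(1) by (auto simp: E0_def)
    show "length b = length fs \<and> c (h # b) \<noteq> 0" if b: "b \<in> tl ` E0" for b
    proof -
      obtain a where a: "a \<in> E" "hd a = h" "b = tl a"
        using b by (auto simp: E0_def)
      then have "a = h # b"
        using split[of a] by simp
      then show ?thesis
        using Cons.prems(6)[OF a(1)] by simp
    qed
    show "(\<Sum>b\<in>tl ` E0. Const (c (h # b)) * list_monom fs b) \<in> Q (Suc 0)"
      using rel by simp
    show "primeideal (Q (Suc i)) (mpoly_ring V)" if "i \<le> length fs" for i
      using Cons.prems(1)[of "Suc i"] that by simp
    show "Q (Suc i) \<subseteq> Q (Suc (Suc i))" if "i < length fs" for i
      using Cons.prems(2)[of "Suc i"] that by simp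
    show "fs ! i \<in> Q (Suc (Suc i)) - Q (Suc i)" if "i < length fs" for i
      using Cons.prems(3)[of "Suc i"] that by simp
  qed
qed

section \<open>Degree bounds and supports of toric images\<close>

definition degree_le :: "nat \<Rightarrow> 'k::field mpoly \<Rightarrow> bool" where
  "degree_le D f \<longleftrightarrow> (\<forall>u\<in>Poly_Mapping.keys f. mdeg u \<le> D)"

lemma degree_le_mult: "degree_le D f \<Longrightarrow> degree_le D' g \<Longrightarrow> degree_le (D + D') (f * g)"
  unfolding degree_le_def using keys_mult[of f g] by (fastforce intro: add_mono)

lemma degree_le_mono: "degree_le D f \<Longrightarrow> D \<le> D' \<Longrightarrow> degree_le D' f"
  unfolding degree_le_def by (meson order_trans)

lemma degree_le_power: "degree_le D f \<Longrightarrow> degree_le (k * D) (f ^ k)"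
  by (induction k) (auto intro: degree_le_mult simp: degree_le_def[of 0])

lemma degree_le_list_monom:
  assumes "\<And>f. f \<in> set fs \<Longrightarrow> degree_le D f" "set a \<subseteq> {..N}"
  shows "degree_le (length fs * (N * D)) (list_monom fs a)"
  using assms
proof (induction fs arbitrary: a)
  case Nil
  then show ?case by (simp add: degree_le_def)
next
  case (Cons f fs)
  show ?case
  proof (cases a)
    case Nil
    then show ?thesis by (simp add: degree_le_def)
  next
    case (Cons h b)
    have "degree_le (N * D) (f ^ h)"
      using Cons Cons.prems by (intro degree_le_mono[OF degree_le_power[of D f h]]) auto
    moreover have "degree_le (length fs * (N * D)) (list_monom fs b)"
      using Cons Cons.prems by (intro Cons.IH) auto
    ultimately show ?thesis
      using Cons degree_le_mult by fastforce
  qed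
qed

lemma ex_degree_le: "\<exists>D. \<forall>f\<in>set fs. degree_le D f"
proof (induction fs)
  case (Cons f fs)
  then obtain D where D: "\<forall>f\<in>set fs. degree_le D f" by blast
  have "degree_le (\<Sum>u\<in>Poly_Mapping.keys f. mdeg u) f"
    unfolding degree_le_def by (auto intro: member_le_sum)
  with D show ?case
    by (intro exI[of _ "D + (\<Sum>u\<in>Poly_Mapping.keys f. mdeg u)"]) (auto intro: degree_le_mono)
qed simp

lemma lookup_toric_exp:
  assumes "\<And>i. i \<in> Poly_Mapping.keys u \<Longrightarrow> finite (edge i)"
  shows "Poly_Mapping.lookup (toric_exp edge u) v =
    (\<Sum>i\<in>Poly_Mapping.keys u. if v \<in> edge i then Poly_Mapping.lookup u i else 0)"
  unfolding toric_exp_def lookup_sum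
  using assms by (intro sum.cong refl) (simp add: lookup_single when_def)

lemma toric_hom_Const_mult: "toric_hom edge (Const c * f) = Const c * toric_hom edge f"
proof -
  have "toric_hom edge (Const c) = Const c"
    by (simp add: Const_def toric_hom_single)
  then show ?thesis by (simp add: toric_hom_mult)
qed

lemma toric_hom_sum: "toric_hom edge (sum f X) = (\<Sum>x\<in>X. toric_hom edge (f x))"
  by (simp add: toric_hom_eq mpoly_extend_sum)

lemma keys_toric_hom: "Poly_Mapping.keys (toric_hom edge f) \<subseteq> toric_exp edge ` Poly_Mapping.keys f"
proof
  fix \<alpha> assume "\<alpha> \<in> Poly_Mapping.keys (toric_hom edge f)"
  then have "(\<Sum>u | u \<in> Poly_Mapping.keys f \<and> toric_exp edge u = \<alpha>. Poly_Mapping.lookup f u) \<noteq> 0"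
    by (simp add: in_keys_iff lookup_toric_hom)
  then show "\<alpha> \<in> toric_exp edge ` Poly_Mapping.keys f"
    by (rule contrapos_np) (intro sum.neutral, blast)
qed

context toric_setting
begin

section \<open>Algebraic dependence of any m elements\<close>

lemma edge_card: "i \<in> {1..n} \<Longrightarrow> edge i \<subseteq> {1..m} \<and> card (edge i) = 2 \<and> finite (edge i)"
  using simple unfolding simple_graph_def by (metis card.infinite zero_neq_numeral)

text \<open>Every edge has one end on each side of the bipartition, so on either side the entries of
  the toric exponent add up to deg u. Equating the two sums expresses the entry at vertex 1 by the
  other m - 1 entries, each at most L; this is why F may drop it.\<close>

lemma card_toric_exps:
  assumes bip: "bipartite_graph m n edge" and m: "m \<ge> 1"
  shows "finite (toric_exp edge ` {u. Poly_Mapping.keys u \<subseteq> {1..n} \<and> mdeg u \<le> L})" (is "finite ?X")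
    and "card (toric_exp edge ` {u. Poly_Mapping.keys u \<subseteq> {1..n} \<and> mdeg u \<le> L}) \<le> (L + 1) ^ (m - 1)"
proof -
  obtain VA VB where V: "VA \<union> VB = {1..m}" "VA \<inter> VB = {}"
    and ed: "\<And>i. i \<in> {1..n} \<Longrightarrow> \<exists>a\<in>VA. \<exists>b\<in>VB. edge i = {a, b}"
    using bip unfolding bipartite_graph_def by (elim exE conjE) (rule that, assumption+, erule (1) bspec)
  have fin: "finite VA" "finite VB"
    using finite_subset[of VA "{1..m}"] finite_subset[of VB "{1..m}"] V(1) by auto
  have lookup: "Poly_Mapping.lookup (toric_exp edge u) v =
      (\<Sum>i\<in>Poly_Mapping.keys u. if v \<in> edge i then Poly_Mapping.lookup u i else 0)"
    if "Poly_Mapping.keys u \<subseteq> {1..n}" for u v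
    using that edge_card by (intro lookup_toric_exp) blast
  have side: "(\<Sum>v\<in>W. Poly_Mapping.lookup (toric_exp edge u) v) = mdeg u"
    if u: "Poly_Mapping.keys u \<subseteq> {1..n}" and W: "W = VA \<or> W = VB" for u W
  proof -
    have "(\<Sum>v\<in>W. Poly_Mapping.lookup (toric_exp edge u) v) =
        (\<Sum>i\<in>Poly_Mapping.keys u. \<Sum>v\<in>W. if v \<in> edge i then Poly_Mapping.lookup u i else 0)"
      unfolding lookup[OF u] by (rule sum.swap)
    also have "\<dots> = mdeg u"
      unfolding mdeg_def
    proof (rule sum.cong[OF refl])
      fix i assume "i \<in> Poly_Mapping.keys u"
      then obtain a b where ab: "a \<in> VA" "b \<in> VB" "edge i = {a, b}"
        using u ed by blast
      then have "W \<inter> edge i = {a} \<or> W \<inter> edge i = {b}"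
        using V(2) W by auto
      then have "card (W \<inter> edge i) = 1" by auto
      then show "(\<Sum>v\<in>W. if v \<in> edge i then Poly_Mapping.lookup u i else 0) = Poly_Mapping.lookup u i"
        using W fin by (auto simp: sum.If_cases)
    qed
    finally show ?thesis .
  qed
  define F where "F \<alpha> = restrict (Poly_Mapping.lookup \<alpha>) ({1..m} - {1})" for \<alpha> :: monomial
  have "F ` ?X \<subseteq> ({1..m} - {1}) \<rightarrow>\<^sub>E {..L}"
  proof
    fix g assume "g \<in> F ` ?X"
    then obtain u where u: "Poly_Mapping.keys u \<subseteq> {1..n}" "mdeg u \<le> L" and g: "g = F (toric_exp edge u)"
      by blast
    have "Poly_Mapping.lookup (toric_exp edge u) v \<le> L" for v
    proof -
      have "Poly_Mapping.lookup (toric_exp edge u) v \<le> mdeg u"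
        unfolding lookup[OF u(1)] mdeg_def by (intro sum_mono) auto
      with u(2) show ?thesis by simp
    qed
    then show "g \<in> ({1..m} - {1}) \<rightarrow>\<^sub>E {..L}"
      by (auto simp: g F_def)
  qed
  moreover have "inj_on F ?X"
  proof (rule inj_onI)
    fix \<alpha> \<beta> assume "\<alpha> \<in> ?X" "\<beta> \<in> ?X" and eq: "F \<alpha> = F \<beta>"
    then obtain u u' where u: "Poly_Mapping.keys u \<subseteq> {1..n}" "\<alpha> = toric_exp edge u"
      and u': "Poly_Mapping.keys u' \<subseteq> {1..n}" "\<beta> = toric_exp edge u'" by blast
    have rest: "Poly_Mapping.lookup \<alpha> v = Poly_Mapping.lookup \<beta> v" if "v \<noteq> 1" for v
    proof (cases "v \<in> {1..m}")
      case True
      then show ?thesis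
        using fun_cong[OF eq, of v] that by (simp add: F_def)
    next
      case False
      then have "v \<notin> edge i" if "i \<in> {1..n}" for i
        using edge_card[OF that] by blast
      then have "\<forall>i\<in>Poly_Mapping.keys u. v \<notin> edge i" "\<forall>i\<in>Poly_Mapping.keys u'. v \<notin> edge i"
        using u u' by blast+
      then show ?thesis
        unfolding u(2) u'(2) lookup[OF u(1)] lookup[OF u'(1)] by simp
    qed
    have "Poly_Mapping.lookup \<alpha> 1 = Poly_Mapping.lookup \<beta> 1"
    proof -
      have "1 \<in> VA \<union> VB"
        unfolding V(1) using m by simp
      then have "1 \<in> VA \<and> 1 \<notin> VB \<or> 1 \<in> VB \<and> 1 \<notin> VA"
        using V(2) by blast
      \<comment> \<open>W is the side containing vertex 1. The sum over the other side W' is known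
        from the remaining entries and gives the sum over W.\<close>
      then obtain W W' where W: "{W, W'} = {VA, VB}" "1 \<in> W" "1 \<notin> W'"
        using insert_commute[of VA VB "{}"] by (elim disjE conjE) (erule that[rotated], assumption, simp)+
      then have W': "W = VA \<or> W = VB" "W' = VA \<or> W' = VB" "finite W"
        using fin by (auto simp: doubleton_eq_iff)
      have "(\<Sum>v\<in>W'. Poly_Mapping.lookup \<alpha> v) = (\<Sum>v\<in>W'. Poly_Mapping.lookup \<beta> v)"
        using W(3) by (intro sum.cong refl rest) auto
      then have "(\<Sum>v\<in>W. Poly_Mapping.lookup \<alpha> v) = (\<Sum>v\<in>W. Poly_Mapping.lookup \<beta> v)"
        using side[OF u(1)] side[OF u'(1)] W' u(2) u'(2) by metis
      moreover have "(\<Sum>v\<in>W - {1}. Poly_Mapping.lookup \<alpha> v) = (\<Sum>v\<in>W - {1}. Poly_Mapping.lookup \<beta> v)"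
        by (intro sum.cong refl rest) auto
      ultimately show ?thesis
        using W(2) W'(3) by (simp add: sum.remove)
    qed
    with rest show "\<alpha> = \<beta>"
      by (intro poly_mapping_eqI) metis
  qed
  moreover have "finite (({1..m} - {1}) \<rightarrow>\<^sub>E {..L})"
    by (intro finite_PiE) auto
  moreover have "card (({1..m} - {1}) \<rightarrow>\<^sub>E {..L}) = (L + 1) ^ (m - 1)"
    using m by (simp add: card_PiE)
  ultimately show "finite ?X" "card ?X \<le> (L + 1) ^ (m - 1)"
    using inj_on_finite[of F ?X] card_inj_on_le[of F ?X "({1..m} - {1}) \<rightarrow>\<^sub>E {..L}"] by auto
qed

text \<open>There are (N+1)^m power products with exponents at most N, and their toric images are
  supported on at most (L+1)^(m-1) exponent vectors, where L bounds the degrees. For suitable N the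
  first number is larger, so some non-trivial combination has toric image 0.\<close>

lemma algebraic_relation:
  assumes bip: "bipartite_graph m n edge" and m: "m \<ge> 1"
    and fs: "set fs \<subseteq> carrier A" "length fs = m"
  shows "\<exists>E c. finite E \<and> E \<noteq> {} \<and> (\<forall>a\<in>E. length a = length fs \<and> c a \<noteq> (0::'k)) \<and>
    (\<Sum>a\<in>E. Const (c a) * list_monom fs a) \<in> toric_ideal m n edge"
proof -
  obtain D where D: "\<And>f. f \<in> set fs \<Longrightarrow> degree_le D f"
    using ex_degree_le by blast
  \<comment> \<open>With L = m N D one has L + 1 <= (D m + 1)(N + 1), so (L+1)^(m-1) <= (D m +
    1)^(m-1) (N+1)^(m-1). Taking N to be the first factor turns this bound into N (N+1)^(m-1), which
    is less than (N+1)^m.\<close>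
  define N where "N = (D * m + 1) ^ (m - 1)"
  define L where "L = m * (N * D)"
  define S where "S = {a. set a \<subseteq> {..N} \<and> length a = m}"
  define X where "X = toric_exp edge ` {u. Poly_Mapping.keys u \<subseteq> {1..n} \<and> mdeg u \<le> L}"
  note cardX = card_toric_exps[OF bip m, of L, folded X_def]
  have "finite S" "card S = (N + 1) ^ m"
    unfolding S_def by (simp_all add: finite_lists_length_eq card_lists_length_eq)
  have "L + 1 \<le> (D * m + 1) * (N + 1)"
    by (simp add: L_def algebra_simps)
  then have "(L + 1) ^ (m - 1) \<le> ((D * m + 1) * (N + 1)) ^ (m - 1)"
    by (rule power_mono) simp
  also have "\<dots> = N * (N + 1) ^ (m - 1)"
    unfolding power_mult_distrib N_def by simp
  also have "\<dots> < (N + 1) * (N + 1) ^ (m - 1)"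
    by simp
  also have "\<dots> = (N + 1) ^ m"
    using m by (simp add: power_eq_if)
  finally have "card X < card S"
    using cardX(2) \<open>card S = (N + 1) ^ m\<close> by simp
  then obtain c where c: "\<exists>a\<in>S. c a \<noteq> 0"
    "\<forall>\<alpha>\<in>X. (\<Sum>a\<in>S. c a * Poly_Mapping.lookup (toric_hom edge (list_monom fs a)) \<alpha>) = 0"
    using underdetermined_system[OF cardX(1) \<open>finite S\<close>,
        of "\<lambda>a. Poly_Mapping.lookup (toric_hom edge (list_monom fs a))"] by blast
  define E where "E = {a \<in> S. c a \<noteq> 0}"
  have mon: "list_monom fs a \<in> carrier A" for a
    using list_monom_closed[OF fs(1)[unfolded A_def]] by (simp add: A_def)
  have "toric_hom edge (\<Sum>a\<in>E. Const (c a) * list_monom fs a) = 0"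
  proof (rule poly_mapping_eqI)
    fix \<alpha>
    have "Poly_Mapping.lookup (toric_hom edge (\<Sum>a\<in>E. Const (c a) * list_monom fs a)) \<alpha> =
        (\<Sum>a\<in>E. c a * Poly_Mapping.lookup (toric_hom edge (list_monom fs a)) \<alpha>)"
      by (simp add: toric_hom_sum toric_hom_Const_mult lookup_sum lookup_Const_times)
    also have "\<dots> = (\<Sum>a\<in>S. c a * Poly_Mapping.lookup (toric_hom edge (list_monom fs a)) \<alpha>)"
      using \<open>finite S\<close> by (intro sum.mono_neutral_left) (auto simp: E_def)
    also have "\<dots> = 0"
    proof (cases "\<alpha> \<in> X")
      case False
      have "Poly_Mapping.lookup (toric_hom edge (list_monom fs a)) \<alpha> = 0" if "a \<in> S" for a
      proof (rule ccontr)
        assume "Poly_Mapping.lookup (toric_hom edge (list_monom fs a)) \<alpha> \<noteq> 0"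
        then have "\<alpha> \<in> toric_exp edge ` Poly_Mapping.keys (list_monom fs a)"
          by (metis in_keys_iff keys_toric_hom subsetD)
        then obtain u where u: "u \<in> Poly_Mapping.keys (list_monom fs a)" "\<alpha> = toric_exp edge u" by blast
        have "degree_le L (list_monom fs a)"
          using degree_le_list_monom[OF D, of fs a N] that fs(2) by (simp add: S_def L_def)
        then have "mdeg u \<le> L" "Poly_Mapping.keys u \<subseteq> {1..n}"
          using u(1) mon[of a] by (simp_all add: degree_le_def in_A_iff)
        then show False
          using u(2) False by (auto simp: X_def)
      qed
      then show ?thesis by simp
    qed (use c(2) in simp)
    finally show "Poly_Mapping.lookup (toric_hom edge (\<Sum>a\<in>E. Const (c a) * list_monom fs a)) \<alpha> =
        Poly_Mapping.lookup 0 \<alpha>" by simp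
  qed
  moreover have "(\<Sum>a\<in>E. Const (c a) * list_monom fs a) \<in> carrier A"
    using mon unfolding A_def by (intro sum_in_mpoly_ring mpoly_ring_closed) auto
  ultimately have "(\<Sum>a\<in>E. Const (c a) * list_monom fs a) \<in> toric_ideal m n edge"
    by (simp add: toric_ideal_iff A_def)
  moreover have "finite E" "E \<noteq> {}" "\<forall>a\<in>E. length a = length fs \<and> c a \<noteq> 0"
    using c(1) \<open>finite S\<close> fs(2) by (auto simp: E_def) (simp add: S_def)
  ultimately show ?thesis by blast
qed

lemma prime_vimage_cl:
  assumes "primeideal P R"
  shows "primeideal {f \<in> carrier A. cl f \<in> P} A"
proof (rule primeidealI)
  interpret P: primeideal P R by fact
  show "ideal {f \<in> carrier A. cl f \<in> P} A"
    by (rule ideal_vimage_cl[OF P.is_ideal])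
  show "cring A" by (rule A.cring_axioms)
  show "carrier A \<noteq> {f \<in> carrier A. cl f \<in> P}"
    using P.I_notcarr P.a_subset unfolding carrier_R by blast
  fix f g assume fg: "f \<in> carrier A" "g \<in> carrier A" "f \<otimes>\<^bsub>A\<^esub> g \<in> {f \<in> carrier A. cl f \<in> P}"
  then show "f \<in> {f \<in> carrier A. cl f \<in> P} \<or> g \<in> {f \<in> carrier A. cl f \<in> P}"
    using P.I_prime[of "cl f" "cl g"] cl_ops(2)[of f g] by auto
qed

lemma prime_chain_length:
  assumes bip: "bipartite_graph m n edge" and m: "m \<ge> 1"
    and prime: "\<And>i. i \<le> d \<Longrightarrow> primeideal (P i) R" and strict: "\<And>i. i < d \<Longrightarrow> P i \<subset> P (Suc i)"
  shows "d \<le> m - 1"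
proof (rule ccontr)
  assume "\<not> d \<le> m - 1"
  then have d: "m \<le> d" using m by simp
  \<comment> \<open>The primes are pulled back to polynomials, where Q 0 contains I(G). One element
    from each of the first m jumps gives m polynomials, and their relation modulo I(G) is a relation
    modulo Q 0.\<close>
  define Q where "Q i = {f \<in> carrier A. cl f \<in> P i}" for i
  have "\<exists>f. f \<in> Q (Suc i) - Q i" if "i < m" for i
  proof -
    have "P i \<subset> P (Suc i)"
      using strict[of i] that d by simp
    then obtain x where x: "x \<in> P (Suc i)" "x \<notin> P i" by blast
    interpret primeideal "P (Suc i)" R
      using prime[of "Suc i"] that d by simp
    obtain f where "f \<in> carrier A" "x = cl f"
      using x(1) a_subset unfolding carrier_R by blast
    with x show ?thesis by (auto simp: Q_def)
  qed
  then obtain f where f: "\<And>i. i < m \<Longrightarrow> f i \<in> Q (Suc i) - Q i" by metis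
  define fs where "fs = map f [0..<m]"
  have fs: "set fs \<subseteq> carrier A" "length fs = m"
    using f by (auto simp: fs_def Q_def)
  obtain E c where E: "finite E" "E \<noteq> {}" "\<forall>a\<in>E. length a = length fs \<and> c a \<noteq> (0::'k)"
    and rel: "(\<Sum>a\<in>E. Const (c a) * list_monom fs a) \<in> toric_ideal m n edge"
    using algebraic_relation[OF bip m fs] by (elim exE conjE) (rule that)
  let ?g = "\<Sum>a\<in>E. Const (c a) * list_monom fs a"
  have gA: "?g \<in> carrier A" and "toric_hom edge ?g = toric_hom edge 0"
    using rel by (simp_all add: toric_ideal_iff A_def toric_hom_simps)
  then have "cl ?g = cl 0"
    by (subst cl_eq_iff) (auto simp: A_def)
  then have "cl ?g \<in> P 0"
    using additive_subgroup.zero_closed[OF ideal.axioms(1)[OF primeideal.axioms(1)[OF prime[of 0]]]]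
    by (simp add: cl_zero)
  then have "?g \<in> Q 0"
    using gA by (simp add: Q_def)
  then show False
  proof (rule prime_chain_no_relation[of fs Q "{1..n}" E c, rotated -1])
    show "primeideal (Q i) (mpoly_ring {1..n})" if "i \<le> length fs" for i
      using prime_vimage_cl[OF prime[of i]] that d unfolding Q_def fs_def A_def by simp
    show "Q i \<subseteq> Q (Suc i)" if "i < length fs" for i
      using strict[of i] that d by (auto simp: Q_def fs_def)
    show "fs ! i \<in> Q (Suc i) - Q i" if "i < length fs" for i
      using f[of i] that by (simp add: fs_def)
  qed (use E in auto)
qed

end

subsection \<open>Krull dimension: lower bound\<close>

text \<open>Vertices are added one at a time along an edge leaving the current set. The gained edge
  e will make consecutive face kernels differ, and the cardinality at stage j guarantees that
  vertices remain while j + 1 < m.\<close>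

lemma connected_graph_exhaustion:
  assumes con: "connected_graph m n edge" and simple: "simple_graph m n edge" and "j < m"
  shows "\<exists>S. (\<forall>i\<le>j. S i \<subseteq> {1..m}) \<and> card (S j) = Suc j \<and>
     (\<forall>i<j. S i \<subseteq> S (Suc i) \<and> (\<exists>e\<in>{1..n}. edge e \<subseteq> S (Suc i) \<and> \<not> edge e \<subseteq> S i))"
  using \<open>j < m\<close>
proof (induction j)
  case 0
  then show ?case
    by (intro exI[of _ "\<lambda>_. {1}"]) auto
next
  case (Suc j)
  then obtain S where S: "\<And>i. i \<le> j \<Longrightarrow> S i \<subseteq> {1..m}" "card (S j) = Suc j"
    "\<And>i. i < j \<Longrightarrow> S i \<subseteq> S (Suc i) \<and> (\<exists>e\<in>{1..n}. edge e \<subseteq> S (Suc i) \<and> \<not> edge e \<subseteq> S i)"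
    by (auto simp: Suc_lessD)
  have Sj: "S j \<subseteq> {1..m}" "S j \<noteq> {}" "finite (S j)"
    using S(1)[of j] S(2) by (auto intro: finite_subset)
  obtain x where x: "x \<in> S j" using Sj by blast
  have "S j \<noteq> {1..m}"
    using S(2) Suc.prems by auto
  then obtain y where y: "y \<in> {1..m}" "y \<notin> S j" using Sj by blast
  have "(x, y) \<in> {(a, b). \<exists>i\<in>{1..n}. edge i = {a, b}}\<^sup>*"
    using con x y Sj unfolding connected_graph_def by blast
  \<comment> \<open>A walk from inside S j to a vertex outside crosses the boundary at some
    edge.\<close>
  then have "\<exists>a b i. a \<in> S j \<and> b \<notin> S j \<and> i \<in> {1..n} \<and> edge i = {a, b}"
    using y(2)
  proof (induction rule: rtrancl_induct)
    case base
    then show ?case using x by simp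
  next
    case (step b c)
    then show ?case by blast
  qed
  then obtain a b i where ab: "a \<in> S j" "b \<notin> S j" "i \<in> {1..n}" "edge i = {a, b}" by blast
  then have b: "b \<in> {1..m}"
    using simple unfolding simple_graph_def by blast
  define S' where "S' = S(Suc j := insert b (S j))"
  have "\<forall>k\<le>Suc j. S' k \<subseteq> {1..m}"
    using S(1) b by (auto simp: S'_def le_Suc_eq)
  moreover have "card (S' (Suc j)) = Suc (Suc j)"
    using S(2) ab(2) Sj by (simp add: S'_def)
  moreover have "S' k \<subseteq> S' (Suc k) \<and> (\<exists>e\<in>{1..n}. edge e \<subseteq> S' (Suc k) \<and> \<not> edge e \<subseteq> S' k)" if "k < Suc j" for k
  proof (cases "k = j")
    case True
    then show ?thesis using ab by (auto simp: S'_def)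
  next
    case False
    then show ?thesis using that S(3)[of k] by (auto simp: S'_def)
  qed
  ultimately show ?case by blast
qed

context toric_setting
begin

definition face_kernel :: "nat set \<Rightarrow> 'k mpoly set" where
  "face_kernel S = {f \<in> carrier A. \<forall>\<alpha>. Poly_Mapping.keys \<alpha> \<subseteq> S \<longrightarrow> Poly_Mapping.lookup (toric_hom edge f) \<alpha> = 0}"

text \<open>The toric map followed by t_v -> 0 for v outside S; \<open>face_kernel S\<close> is its
  kernel, spelled out in coefficients.\<close>

definition face_hom :: "nat set \<Rightarrow> 'k mpoly \<Rightarrow> 'k mpoly" where
  "face_hom S = mpoly_extend (\<lambda>u. if Poly_Mapping.keys (toric_exp edge u) \<subseteq> S
     then Poly_Mapping.single (toric_exp edge u) 1 else 0)"

text \<open>A sum of exponent vectors is supported in S exactly when both summands are, because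
  entries are natural numbers. This face property makes the truncated map multiplicative; as its
  values lie in an integral domain, its kernel is prime.\<close>

lemma face_hom_mult: "face_hom S (f * g) = face_hom S f * face_hom S g"
  unfolding face_hom_def by (rule mpoly_extend_mult) (simp add: mult_single)

lemma lookup_face_hom:
  "Poly_Mapping.lookup (face_hom S f) \<alpha> =
    (if Poly_Mapping.keys \<alpha> \<subseteq> S then Poly_Mapping.lookup (toric_hom edge f) \<alpha> else 0)"
proof -
  have "Poly_Mapping.lookup (face_hom S f) \<alpha> = (\<Sum>u\<in>Poly_Mapping.keys f.
      if Poly_Mapping.keys (toric_exp edge u) \<subseteq> S \<and> toric_exp edge u = \<alpha> then Poly_Mapping.lookup f u else 0)"
    unfolding face_hom_def mpoly_extend_def lookup_sum
    by (intro sum.cong refl) (auto simp: lookup_single when_def)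
  moreover have "Poly_Mapping.lookup (toric_hom edge f) \<alpha> = (\<Sum>u\<in>Poly_Mapping.keys f.
      if toric_exp edge u = \<alpha> then Poly_Mapping.lookup f u else 0)"
    unfolding toric_hom_eq mpoly_extend_def lookup_sum
    by (intro sum.cong refl) (simp add: lookup_single when_def)
  ultimately show ?thesis
    by (cases "Poly_Mapping.keys \<alpha> \<subseteq> S") (auto intro!: sum.cong sum.neutral)
qed

lemma face_kernel_iff: "f \<in> face_kernel S \<longleftrightarrow> f \<in> carrier A \<and> face_hom S f = 0"
  by (auto simp: face_kernel_def poly_mapping_eq_iff fun_eq_iff lookup_face_hom)

text \<open>Being defined through the toric image, \<open>face_kernel S\<close> is a union of cosets
  of I(G), so membership may be tested on any representative.\<close>

lemma cl_in_face_kernel: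
  assumes "f \<in> carrier A" "cl f \<in> cl ` face_kernel S"
  shows "f \<in> face_kernel S"
proof -
  obtain g where g: "g \<in> face_kernel S" "cl f = cl g"
    using assms(2) by blast
  then have "toric_hom edge f = toric_hom edge g"
    using cl_eq_iff[of f g] assms(1) by (simp add: face_kernel_iff)
  with g(1) assms(1) show ?thesis by (simp add: face_kernel_def)
qed

lemma prime_face_kernel: "primeideal (cl ` face_kernel S) R"
proof (rule primeidealI)
  show "ideal (cl ` face_kernel S) R"
  proof (intro ideal_image_cl A_idealI)
    fix f g assume f: "f \<in> face_kernel S" and g: "g \<in> carrier A"
    then show "g * f \<in> face_kernel S"
      using A_closed(4)[of g f] by (simp add: face_kernel_iff face_hom_mult)
  qed (auto simp: face_kernel_def toric_hom_simps toric_hom_add lookup_add intro: A_closed, auto simp: A_def)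
  show "cring R" by (rule R.cring_axioms)
  have "1 \<notin> face_kernel S"
    by (auto simp: face_kernel_def toric_hom_simps intro!: exI[of _ 0])
  moreover have one: "1 \<in> carrier A"
    by (simp add: in_A_iff)
  ultimately have "cl 1 \<notin> cl ` face_kernel S"
    using cl_in_face_kernel[of 1] by blast
  then show "carrier R \<noteq> cl ` face_kernel S"
    using one unfolding carrier_R by blast
  fix x y assume "x \<in> carrier R" "y \<in> carrier R" and xy: "x \<otimes>\<^bsub>R\<^esub> y \<in> cl ` face_kernel S"
  then obtain f g where fg: "f \<in> carrier A" "x = cl f" "g \<in> carrier A" "y = cl g"
    unfolding carrier_R by blast
  then have "f * g \<in> face_kernel S"
    using xy cl_ops(2)[of f g] A_closed(4)[of f g] by (intro cl_in_face_kernel) auto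
  then have "face_hom S f = 0 \<or> face_hom S g = 0"
    by (simp add: face_kernel_iff face_hom_mult)
  then show "x \<in> cl ` face_kernel S \<or> y \<in> cl ` face_kernel S"
    using fg by (auto simp: face_kernel_iff)
qed

text \<open>As the toric map doubles degrees, 1 is the only monomial sent to 1. The exponent 0 is
  supported in every S, so members of \<open>face_kernel S\<close> have constant coefficient
  0.\<close>

lemma face_kernel_subset_origin: "cl ` face_kernel S \<subseteq> toric_origin m n edge"
proof -
  have "f \<in> order_ge 1" if f: "f \<in> face_kernel S" for f
  proof -
    have "1 \<le> mdeg u" if u: "u \<in> Poly_Mapping.keys f" for u
    proof (rule ccontr)
      assume "\<not> 1 \<le> mdeg u"
      then have u0: "u = 0"
        by (simp add: mdeg_eq_0D not_less_eq_eq)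
      have "v = 0" if "v \<in> Poly_Mapping.keys f" "toric_exp edge v = 0" for v
      proof -
        have "Poly_Mapping.keys v \<subseteq> {1..n}"
          using that(1) f by (simp add: face_kernel_iff in_A_iff)
        then have "mdeg v = 0"
          using mdeg_toric[of v] that(2) by simp
        then show ?thesis
          by (rule mdeg_eq_0D)
      qed
      then have "{v \<in> Poly_Mapping.keys f. toric_exp edge v = 0} = {0}"
        using u u0 by auto
      then have "Poly_Mapping.lookup (toric_hom edge f) 0 = Poly_Mapping.lookup f 0"
        by (simp add: lookup_toric_hom)
      also have "Poly_Mapping.lookup (toric_hom edge f) 0 = 0"
        using f by (simp add: face_kernel_def)
      finally show False
        using u u0 by (simp add: in_keys_iff)
    qed
    then show ?thesis
      using f by (simp add: order_ge_def face_kernel_iff)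
  qed
  then show ?thesis
    unfolding toric_origin_eq by blast
qed

text \<open>The variable of the gained edge e is the witness: its image survives setting t_v to 0
  outside S', but not outside S.\<close>

lemma face_kernel_strict:
  assumes "S \<subseteq> S'" "e \<in> {1..n}" "edge e \<subseteq> S'" "\<not> edge e \<subseteq> S"
  shows "cl ` face_kernel S' \<subset> cl ` face_kernel S"
proof -
  have keys: "Poly_Mapping.keys (toric_exp edge (Poly_Mapping.single e 1)) = edge e"
    using edge_card[OF assms(2)] by (auto simp: in_keys_iff lookup_toric_exp_single split: if_splits)
  have V: "Var e \<in> carrier A"
    using assms(2) by (simp add: A_def Var_in_mpoly_ring)
  have "Var e \<in> face_kernel S"
    using V assms(4) keys
    by (auto simp: face_kernel_def Var_def toric_hom_single lookup_single when_def)
  moreover have "Var e \<notin> face_kernel S'"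
    using V assms(3) keys
    by (auto simp: face_kernel_def Var_def toric_hom_single lookup_single)
  then have "cl (Var e) \<notin> cl ` face_kernel S'"
    using cl_in_face_kernel[OF V] by blast
  moreover have "face_kernel S' \<subseteq> face_kernel S"
    using assms(1) by (auto simp: face_kernel_def)
  ultimately show ?thesis by blast
qed

lemma krull_dim_origin:
  assumes "bipartite_graph m n edge" "connected_graph m n edge" "m \<ge> 1"
  shows "krull_dim_at R (toric_origin m n edge) = enat (m - 1)"
  unfolding krull_dim_at_def
proof (rule antisym)
  let ?D = "{enat d | d. \<exists>P. (\<forall>i\<le>d. primeideal (P i) R) \<and> (\<forall>i<d. P i \<subset> P (Suc i)) \<and> P d \<subseteq> toric_origin m n edge}"
  show "Sup ?D \<le> enat (m - 1)"
  proof (rule Sup_least)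
    fix x assume "x \<in> ?D"
    then obtain d P where "x = enat d" "\<forall>i\<le>d. primeideal (P i) R" "\<forall>i<d. P i \<subset> P (Suc i)"
      by blast
    then show "x \<le> enat (m - 1)"
      using prime_chain_length[OF assms(1,3), of d P] by simp
  qed
  obtain S where S: "\<And>i. i < m - 1 \<Longrightarrow> S i \<subseteq> S (Suc i) \<and> (\<exists>e\<in>{1..n}. edge e \<subseteq> S (Suc i) \<and> \<not> edge e \<subseteq> S i)"
    using connected_graph_exhaustion[OF assms(2) simple, of "m - 1"] assms(3) by auto
  \<comment> \<open>Larger vertex sets have smaller kernels, so the exhaustion is traversed
    backwards. The m sets S 0, ..., S (m - 1) give m primes, a chain of length m - 1.\<close>
  define P where "P i = cl ` face_kernel (S (m - 1 - i))" for i
  have "P i \<subset> P (Suc i)" if "i < m - 1" for i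
  proof -
    have "m - 1 - i = Suc (m - 1 - Suc i)" "m - 1 - Suc i < m - 1"
      using that by auto
    then show ?thesis
      using S[of "m - 1 - Suc i"] face_kernel_strict[of "S (m - 1 - Suc i)" "S (m - 1 - i)"]
      unfolding P_def by metis
  qed
  moreover have "primeideal (P i) R" "P i \<subseteq> toric_origin m n edge" for i
    unfolding P_def by (rule prime_face_kernel face_kernel_subset_origin)+
  ultimately have "enat (m - 1) \<in> ?D"
    by blast
  then show "enat (m - 1) \<le> Sup ?D"
    by (rule Sup_upper)
qed

end

subsection \<open>The multiplicity\<close>

lemma poly_eventually_eq:
  assumes "\<forall>\<^sub>F k in sequentially. poly P (real k) = poly Q (real k)"
  shows "P = Q"
proof (rule ccontr)
  assume "P \<noteq> Q"
  then have "finite {x. poly (P - Q) x = 0}"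
    by (intro poly_roots_finite) simp
  moreover obtain N where "\<And>k. k \<ge> N \<Longrightarrow> poly P (real k) = poly Q (real k)"
    using assms unfolding eventually_sequentially by blast
  then have "real ` {N..} \<subseteq> {x. poly (P - Q) x = 0}" by auto
  ultimately have "finite (real ` {N..})"
    by (rule finite_subset[rotated])
  then show False
    using finite_imageD[of real "{N..}"] infinite_Ici by (auto simp: inj_on_def)
qed

text \<open>The definite description is unambiguous: the Krull dimension fixes d, and two
  polynomials that agree at all large integers are equal.\<close>

lemma hs_multiplicity_eqI:
  assumes "krull_dim_at R M = enat (d + 1)"
    and "\<forall>\<^sub>F k in sequentially. poly P (real k) = real (gr_dim R K M k)"
  shows "hs_multiplicity R K M = fact d * Polynomial.coeff P d"
  unfolding hs_multiplicity_def
proof (rule the_equality)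
  fix e assume "\<exists>d (P :: real poly). krull_dim_at R M = enat (d + 1) \<and>
      (\<forall>\<^sub>F k in sequentially. poly P (real k) = real (gr_dim R K M k)) \<and> e = fact d * Polynomial.coeff P d"
  then obtain d' Q where d': "krull_dim_at R M = enat (d' + 1)"
    and Q: "\<forall>\<^sub>F k in sequentially. poly Q (real k) = real (gr_dim R K M k)"
    and e: "e = fact d' * Polynomial.coeff Q d'" by blast
  have "\<forall>\<^sub>F k in sequentially. poly P (real k) = poly Q (real k)"
    using assms(2) Q by eventually_elim simp
  then show "e = fact d * Polynomial.coeff P d"
    using poly_eventually_eq[of P Q] assms(1) d' e by simp
qed (use assms in blast)

theorem theorem1p2:
  fixes m n p :: "nat"
    and edge :: "nat \<Rightarrow> nat set"
  assumes "n \<ge> 1"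
    and "simple_graph m n edge"
    and "connected_graph m n edge"
    and "bipartite_graph m n edge"
    and "generated_by_quadratic_binomials n (toric_ideal m n edge :: 'k::field mpoly set)"
    and "has_good_choice n edge"
    and "p = card (four_cycles n edge)"
  shows "hs_multiplicity (toric_ring m n edge :: 'k mpoly set ring)
           (toric_scalars m n edge) (toric_origin m n edge) =
         fact (m - 2) / fact (n - 1) *
           (\<Sum>r = 0..p. (- 1) ^ r * real (p choose r) *
              (\<Sum>i = 0..n + 1 - m. (- 1) ^ i * real (stirling n (m + i - 1)) *
                 real ((m + i - 2) choose i) * (2 * real r) ^ i))"
proof -
  interpret toric_setting m n edge "mpoly_ring {1..n} :: 'k mpoly ring" "toric_ring m n edge"
    using assms(2) by unfold_locales simp_all
  \<comment> \<open>An edge has two ends, so m - 2 is not truncated and the Krull dimension m - 1 is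
    (m - 2) + 1.\<close>
  have m: "m \<ge> 2"
    using edge_card[of 1] card_mono[of "{1..m}" "edge 1"] assms(1) by simp
  have "\<forall>\<^sub>F k in sequentially. poly (hilbert_poly n p) (real k) =
      real (gr_dim (toric_ring m n edge :: 'k mpoly set ring) (toric_scalars m n edge) (toric_origin m n edge) k)"
    using eventually_gt_at_top[of "2 * p"]
  proof eventually_elim
    case (elim k)
    then obtain B where "B \<subseteq> monomials n k" "inj_on (toric_exp edge) B"
      "toric_exp edge ` B = toric_exp edge ` monomials n k"
      "real (card B) = poly (hilbert_poly n p) (real k)"
      using toric_monomial_basis[OF assms(2,5,6,1)] unfolding assms(7) by metis
    then show ?case
      using gr_dim_eq_card[of B k] by simp
  qed
  moreover have "krull_dim_at (toric_ring m n edge :: 'k mpoly set ring) (toric_origin m n edge) = enat (m - 2 + 1)"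
    using krull_dim_origin[OF assms(4,3)] m by simp
  ultimately have "hs_multiplicity (toric_ring m n edge :: 'k mpoly set ring)
      (toric_scalars m n edge) (toric_origin m n edge) =
      fact (m - 2) * Polynomial.coeff (hilbert_poly n p) (m - 2)"
    by (intro hs_multiplicity_eqI)
  then show ?thesis
    using coeff_hilbert_poly[OF assms(1) m, of p] by simp
qed

end
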